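(* Let $L$ and $K$ be even lattices of signatures $(b_+,b_-)$ and $(a_+,a_-)$, and let $v\in\operatorname{Gr}(L_{\mathbb{R}})$ and $w\in\operatorname{Gr}(K_{\mathbb{R}})$. Assume that there is a group isomorphism $\iota:L\to K$ such that its extension $\iota_{\mathbb{R}}:L_{\mathbb{R}}\to K_{\mathbb{R}}$ takes each of the spaces $v_\pm$ onto the respective space $w_\pm$ (so that in particular $a_+=b_+$ and $a_-=b_-$). Define $L+_\iota K$ to be $L$ as a group, endowed with the quadratic form $\lambda\mapsto\frac{\lambda^2}{2}+\frac{(\iota\lambda)^2}{2}$, and let $v+_\iota w$ be the vector space decomposition of $(L+_\iota K)_{\mathbb{R}}=L_{\mathbb{R}}$ as $v_+\oplus v_-$. Then $L+_\iota K$ is a (non-degenerate) lattice of the same signature $(b_+,b_-)$ as $L$ and $K$, and $v+_\iota w$ represents an element of $\operatorname{Gr}\big((L+_\iota K)_{\mathbb{R}}\big)$. Moreover, if $\Gamma$ is a finite index subgroup of $\operatorname{Mp}_2(\mathbb{Z})$, $\Phi$ is a Jacobi form of weight $(k,l)$ and index $(L,v)$ with respect to $\Gamma$, and $\Psi$ is a Jacobi form of weight $(\kappa,\mu)$ and index $(K,w)$ with respect to $\Gamma$, then the map $\Phi\Psi$ taking $\tau\in\mathcal{H}$ and $\zeta\in L_{\mathbb{C}}$ to $\Phi(\tau,\zeta)\Psi(\tau,\iota_{\mathbb{C}}\zeta)$ is a Jacobi form of weight $(k+\kappa,l+\mu)$ and index $(L+_\iota K,v+_\iota w)$ with respect to 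$\Gamma$.
   Context: Lattices. An even lattice is a free $\mathbb{Z}$-module $L$ of finite rank with a non-degenerate symmetric bilinear form $(\cdot,\cdot):L\times L\to\mathbb{Z}$ such that $\lambda^2:=(\lambda,\lambda)$ is even for every $\lambda\in L$; the associated quadratic form is $\lambda\mapsto\frac{\lambda^2}{2}$. Put $L_{\mathbb{R}}=L\otimes\mathbb{R}$, $L_{\mathbb{C}}=L\otimes\mathbb{C}$; the pairing and $\lambda\mapsto\lambda^2$ are extended bilinearly (no complex conjugation). The signature of $L$ is that of $L_{\mathbb{R}}$. The dual lattice is $L^*=\{\lambda\in L_{\mathbb{R}}:(\lambda,L)\subseteq\mathbb{Z}\}\supseteq L$. Write $\mathbf{e}(w)=e^{2\pi iw}$ and $\mathcal{H}=\{\tau=x+iy\in\mathbb{C}:y>0\}$. $\operatorname{Gr}(L_{\mathbb{R}})$ is the set of orthogonal decompositions $v$: $L_{\mathbb{R}}=v_+\oplus v_-$ with $v_+$ positive definite and $v_-$ negative definite; $\lambda_{v_\pm}$ is the orthogonal projection of $\lambda$ onto $v_\pm$, extended complex linearly to $\zeta\mapsto\zeta_{v_\pm}$ on $L_{\mathbb{C}}$. $\iota_{\mathbb{R}}$, $\iota_{\mathbb{C}}$ are the scalar extensions of $\iota$. Metaplectic group. For $A=\begin{pmatrix}a&b\\c&d\end{pmatrix}\in\operatorname{SL}_2(\mathbb{R})$ put $A\tau=\frac{a\tau+b}{c\tau+d}$, $j(A,\tau)=c\tau+d$, $j_A'=c$. $\operatorname{Mp}_2(\mathbb{R})$ is the group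 of pairs $(A,\phi)$ with $A\in\operatorname{SL}_2(\mathbb{R})$, $\phi:\mathcal{H}\to\mathbb{C}$ holomorphic, $\phi^2(\tau)=j(A,\tau)$, with product $(A,\phi)(B,\psi)=(AB,(\phi\circ B)\psi)$; $\operatorname{Mp}_2(\mathbb{Z})$ is the inverse image of $\operatorname{SL}_2(\mathbb{Z})$. Jacobi forms. For $k,l\in\frac12\mathbb{Z}$, a Jacobi form of weight $(k,l)$ and index $(L,v)$ with respect to $\Gamma$ is a smooth $\Phi:\mathcal{H}\times L_{\mathbb{C}}\to\mathbb{C}$ such that: (1) for all $\tau,\zeta$ and $\sigma,\nu\in L$, $\Phi(\tau,\zeta+\tau\sigma_{v_+}+\overline\tau\sigma_{v_-}+\nu)=\mathbf{e}\big(-\tau\frac{\sigma_{v_+}^2}{2}-\overline\tau\frac{\sigma_{v_-}^2}{2}-(\sigma,\zeta)\big)\Phi(\tau,\zeta)$; (2) for all $\tau,\zeta$ and $(A,\phi)\in\Gamma$, $$\Phi\Big(A\tau,\tfrac{\zeta_{v_+}}{j(A,\tau)}+\tfrac{\zeta_{v_-}}{\overline{j(A,\tau)}}\Big)=\phi(\tau)^{2k}\overline{\phi(\tau)}^{2l}\,\mathbf{e}\Big(\tfrac{j_A'\zeta_{v_+}^2}{2j(A,\tau)}+\tfrac{j_A'\zeta_{v_-}^2}{2\overline{j(A,\tau)}}\Big)\Phi(\tau,\zeta);$$ (3) $\zeta\mapsto\Phi(\tau,\zeta)$ is holomorphic for each $\tau$; (4) the functions $f_\lambda$ ($\lambda\in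 L^*$) in the Fourier expansion $\Phi(\tau,\zeta)=\sum_{\lambda\in L^*}f_\lambda(\tau)\mathbf{e}\big(\tau\frac{\lambda_{v_+}^2}{2}+\overline\tau\frac{\lambda_{v_-}^2}{2}+(\lambda,\zeta)\big)$ have at most linear exponential growth at the cusps: for every $A\in\operatorname{SL}_2(\mathbb{Z})$ there is a constant $C$ with $f_\lambda(A\tau)=O(e^{Cy})$ as $y\to\infty$, uniformly for $x$ in bounded sets. *)

theory Defs
  imports "HOL-Analysis.Analysis" "HOL-Algebra.Coset"
begin

section \<open>Even lattices\<close>

text \<open>
  The ambient type \<open>'a\<close> is the real vector space \<open>L \<otimes> \<real>\<close>: a lattice \<open>L\<close> is the \<open>\<int>\<close>-span of
  an \<open>\<real>\<close>-basis of \<open>'a\<close>, and its bilinear form is given through its bilinear extension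
  \<open>B\<close> to \<open>'a\<close>. Finite-dimensionality of \<open>'a\<close> is a consequence. The norm of \<open>'a\<close> only serves to
  express smoothness and holomorphy; as all norms on a finite-dimensional space are equivalent,
  its choice is immaterial. Rank \<open>0\<close> is included.
\<close>

definition free_lattice :: "'a::real_normed_vector set \<Rightarrow> bool" where
  "free_lattice L \<longleftrightarrow>
     (\<exists>S. finite S \<and> independent S \<and> span S = UNIV \<and>
          L = {\<Sum>x\<in>S. of_int (c x) *\<^sub>R x | c :: 'a \<Rightarrow> int. True})"

definition even_lattice :: "'a::real_normed_vector set \<Rightarrow> ('a \<Rightarrow> 'a \<Rightarrow> real) \<Rightarrow> bool" where
  "even_lattice L B \<longleftrightarrow>
     free_lattice L \<and>
     bilinear B \<and> (\<forall>x y. B x y = B y x) \<and>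
     (\<forall>x\<in>L. \<forall>y\<in>L. B x y \<in> \<int>) \<and>
     (\<forall>x\<in>L. \<exists>n::int. B x x = 2 * of_int n) \<and>
     (\<forall>x\<in>L. (\<forall>y\<in>L. B x y = 0) \<longrightarrow> x = 0)"

definition has_signature :: "('a::real_normed_vector \<Rightarrow> 'a \<Rightarrow> real) \<Rightarrow> nat \<Rightarrow> nat \<Rightarrow> bool" where
  "has_signature B p q \<longleftrightarrow>
     (\<exists>S. finite S \<and> independent S \<and> span S = UNIV \<and>
          (\<forall>x\<in>S. \<forall>y\<in>S. x \<noteq> y \<longrightarrow> B x y = 0) \<and>
          card {x\<in>S. B x x > 0} = p \<and> card {x\<in>S. B x x < 0} = q)"

definition dual_lattice :: "'a::real_normed_vector set \<Rightarrow> ('a \<Rightarrow> 'a \<Rightarrow> real) \<Rightarrow> 'a set" where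
  "dual_lattice L B = {x. \<forall>y\<in>L. B x y \<in> \<int>}"

text \<open>Elements of the Grassmannian are pairs \<open>(v\<^sub>+, v\<^sub>-)\<close>.\<close>

definition Gr :: "('a::real_normed_vector \<Rightarrow> 'a \<Rightarrow> real) \<Rightarrow> ('a set \<times> 'a set) set" where
  "Gr B = {(P, N). subspace P \<and> subspace N \<and>
      P \<inter> N = {0} \<and> (\<forall>x. \<exists>p\<in>P. \<exists>n\<in>N. x = p + n) \<and>
      (\<forall>p\<in>P. \<forall>n\<in>N. B p n = 0) \<and>
      (\<forall>p\<in>P. p \<noteq> 0 \<longrightarrow> B p p > 0) \<and>
      (\<forall>n\<in>N. n \<noteq> 0 \<longrightarrow> B n n < 0)}"

definition orth_proj ::
  "('a::real_normed_vector \<Rightarrow> 'a \<Rightarrow> real) \<Rightarrow> 'a set \<Rightarrow> 'a \<Rightarrow> 'a" where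
  "orth_proj B U x = (THE p. p \<in> U \<and> (\<forall>u\<in>U. B (x - p) u = 0))"


section \<open>Complexification\<close>

text \<open>The pair \<open>(x, y)\<close> stands for \<open>x + \<i> y\<close>.\<close>

type_synonym 'a cplx = "'a \<times> 'a"

definition cscale :: "complex \<Rightarrow> 'a::real_normed_vector cplx \<Rightarrow> 'a cplx" where
  "cscale c z = (Re c *\<^sub>R fst z - Im c *\<^sub>R snd z, Re c *\<^sub>R snd z + Im c *\<^sub>R fst z)"

definition of_lat :: "'a::real_normed_vector \<Rightarrow> 'a cplx" where
  "of_lat x = (x, 0)"

text \<open>The complex linear extension of a real linear map, and the complex bilinear
  (not sesquilinear) extension of a real bilinear form.\<close>

definition cext :: "('a \<Rightarrow> 'b) \<Rightarrow> 'a cplx \<Rightarrow> 'b cplx" where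
  "cext f z = (f (fst z), f (snd z))"

definition cform :: "('a \<Rightarrow> 'a \<Rightarrow> real) \<Rightarrow> 'a cplx \<Rightarrow> 'a cplx \<Rightarrow> complex" where
  "cform B z w = Complex (B (fst z) (fst w) - B (snd z) (snd w))
                         (B (fst z) (snd w) + B (snd z) (fst w))"

abbreviation csq :: "('a \<Rightarrow> 'a \<Rightarrow> real) \<Rightarrow> 'a cplx \<Rightarrow> complex" where
  "csq B z \<equiv> cform B z z"

abbreviation cproj_pos ::
  "('a::real_normed_vector \<Rightarrow> 'a \<Rightarrow> real) \<Rightarrow> 'a set \<times> 'a set \<Rightarrow> 'a cplx \<Rightarrow> 'a cplx" where
  "cproj_pos B v \<equiv> cext (orth_proj B (fst v))"

abbreviation cproj_neg ::
  "('a::real_normed_vector \<Rightarrow> 'a \<Rightarrow> real) \<Rightarrow> 'a set \<times> 'a set \<Rightarrow> 'a cplx \<Rightarrow> 'a cplx" where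
  "cproj_neg B v \<equiv> cext (orth_proj B (snd v))"


section \<open>The metaplectic group\<close>

definition ee :: "complex \<Rightarrow> complex" where
  "ee w = exp (2 * of_real pi * \<i> * w)"

definition uhp :: "complex set" where
  "uhp = {\<tau>. Im \<tau> > 0}"

definition SL2R :: "(real^2^2) set" where
  "SL2R = {A. det A = 1}"

definition SL2Z :: "(real^2^2) set" where
  "SL2Z = {A \<in> SL2R. \<forall>i j. A $ i $ j \<in> \<int>}"

definition act :: "real^2^2 \<Rightarrow> complex \<Rightarrow> complex" where
  "act A = moebius (of_real (A$1$1)) (of_real (A$1$2)) (of_real (A$2$1)) (of_real (A$2$2))"

definition jfac :: "real^2^2 \<Rightarrow> complex \<Rightarrow> complex" where
  "jfac A \<tau> = of_real (A$2$1) * \<tau> + of_real (A$2$2)"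

type_synonym mp2 = "(real^2^2) \<times> (complex \<Rightarrow> complex)"

text \<open>A function on the upper half-plane is represented by its extension with the value
  \<open>undefined\<close> elsewhere, so that equality of pairs is equality of functions on \<open>uhp\<close>.\<close>

definition Mp2R :: "mp2 monoid" where
  "Mp2R = \<lparr>
     carrier = {(A, \<phi>). A \<in> SL2R \<and> \<phi> \<in> extensional uhp \<and> \<phi> holomorphic_on uhp \<and>
                        (\<forall>\<tau>\<in>uhp. (\<phi> \<tau>)\<^sup>2 = jfac A \<tau>)},
     monoid.mult = (\<lambda>(A, \<phi>) (B, \<psi>). (A ** B, \<lambda>\<tau>\<in>uhp. \<phi> (act B \<tau>) * \<psi> \<tau>)),
     one = (mat 1, \<lambda>\<tau>\<in>uhp. 1) \<rparr>"

definition Mp2Z :: "mp2 monoid" where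
  "Mp2Z = Mp2R \<lparr> carrier := {g \<in> carrier Mp2R. fst g \<in> SL2Z} \<rparr>"

definition finite_index_subgroup :: "mp2 set \<Rightarrow> bool" where
  "finite_index_subgroup \<Gamma> \<longleftrightarrow> subgroup \<Gamma> Mp2Z \<and> finite (rcosets\<^bsub>Mp2Z\<^esub> \<Gamma>)"


section \<open>Jacobi forms\<close>

text \<open>\<open>f\<close> is \<open>n\<close> times differentiable (with continuous derivatives) on the open set \<open>S\<close>; the
  domain is finite-dimensional in all uses, so directional derivatives of Frechet derivatives
  suffice.\<close>

fun times_differentiable_on ::
  "nat \<Rightarrow> 'a::real_normed_vector set \<Rightarrow> ('a \<Rightarrow> 'b::real_normed_vector) \<Rightarrow> bool" where
  "times_differentiable_on 0 S f \<longleftrightarrow> continuous_on S f"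
| "times_differentiable_on (Suc n) S f \<longleftrightarrow>
     (\<forall>x\<in>S. f differentiable (at x)) \<and>
     (\<forall>h. times_differentiable_on n S (\<lambda>x. frechet_derivative f (at x) h))"

definition smooth_on ::
  "'a::real_normed_vector set \<Rightarrow> ('a \<Rightarrow> 'b::real_normed_vector) \<Rightarrow> bool" where
  "smooth_on S f \<longleftrightarrow> (\<forall>n. times_differentiable_on n S f)"

definition cplx_holomorphic :: "('a::real_normed_vector cplx \<Rightarrow> complex) \<Rightarrow> bool" where
  "cplx_holomorphic f \<longleftrightarrow>
     (\<forall>\<zeta>. \<exists>D. (f has_derivative D) (at \<zeta>) \<and> (\<forall>c z. D (cscale c z) = c * D z))"

definition half_integers :: "real set" where
  "half_integers = {k. 2 * k \<in> \<int>}"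

definition linear_exp_growth_at_cusps :: "(complex \<Rightarrow> complex) \<Rightarrow> bool" where
  "linear_exp_growth_at_cusps f \<longleftrightarrow>
     (\<forall>A\<in>SL2Z. \<exists>C::real. \<forall>X::real set. bounded X \<longrightarrow>
        (\<exists>M. \<forall>\<^sub>F y in at_top. \<forall>x\<in>X. norm (f (act A (Complex x y))) \<le> M * exp (C * y)))"

text \<open>\<open>f x\<close>, for \<open>x\<close> in the dual lattice, are the coefficient functions of the Fourier
  expansion of \<open>\<Phi>\<close>. (They are determined on \<open>uhp\<close> by \<open>\<Phi>\<close>: the series is unconditionally
  convergent, hence uniformly so on real translates.)\<close>

definition fourier_expansion ::
  "'a::real_normed_vector set \<Rightarrow> ('a \<Rightarrow> 'a \<Rightarrow> real) \<Rightarrow> 'a set \<times> 'a set \<Rightarrow>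
   (complex \<Rightarrow> 'a cplx \<Rightarrow> complex) \<Rightarrow> ('a \<Rightarrow> complex \<Rightarrow> complex) \<Rightarrow> bool" where
  "fourier_expansion L B v \<Phi> f \<longleftrightarrow>
     (\<forall>\<tau>\<in>uhp. \<forall>\<zeta>.
        ((\<lambda>x. f x \<tau> * ee (\<tau> * csq B (cproj_pos B v (of_lat x)) / 2
                          + cnj \<tau> * csq B (cproj_neg B v (of_lat x)) / 2
                          + cform B (of_lat x) \<zeta>))
         has_sum \<Phi> \<tau> \<zeta>) (dual_lattice L B))"

text \<open>\<open>\<Phi> \<tau> \<zeta>\<close> is only relevant for \<open>\<tau> \<in> uhp\<close>. The weights \<open>k\<close>, \<open>l\<close> are meant to be
  half-integers, so that \<open>\<lfloor>2 * k\<rfloor>\<close> is just \<open>2 * k\<close> as an integer.\<close>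

definition jacobi_form ::
  "mp2 set \<Rightarrow> real \<Rightarrow> real \<Rightarrow>
   'a::real_normed_vector set \<Rightarrow> ('a \<Rightarrow> 'a \<Rightarrow> real) \<Rightarrow> 'a set \<times> 'a set \<Rightarrow>
   (complex \<Rightarrow> 'a cplx \<Rightarrow> complex) \<Rightarrow> bool" where
  "jacobi_form \<Gamma> k l L B v \<Phi> \<longleftrightarrow>
     smooth_on (uhp \<times> UNIV) (\<lambda>(\<tau>, \<zeta>). \<Phi> \<tau> \<zeta>) \<and>
     (\<forall>\<tau>\<in>uhp. \<forall>\<zeta>. \<forall>\<sigma>\<in>L. \<forall>\<nu>\<in>L.
        \<Phi> \<tau> (\<zeta> + cscale \<tau> (cproj_pos B v (of_lat \<sigma>))
               + cscale (cnj \<tau>) (cproj_neg B v (of_lat \<sigma>)) + of_lat \<nu>)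
        = ee (- \<tau> * csq B (cproj_pos B v (of_lat \<sigma>)) / 2
              - cnj \<tau> * csq B (cproj_neg B v (of_lat \<sigma>)) / 2
              - cform B (of_lat \<sigma>) \<zeta>) * \<Phi> \<tau> \<zeta>) \<and>
     (\<forall>\<tau>\<in>uhp. \<forall>\<zeta>. \<forall>(A, \<phi>)\<in>\<Gamma>.
        \<Phi> (act A \<tau>) (cscale (1 / jfac A \<tau>) (cproj_pos B v \<zeta>)
                      + cscale (1 / cnj (jfac A \<tau>)) (cproj_neg B v \<zeta>))
        = \<phi> \<tau> powi \<lfloor>2 * k\<rfloor> * cnj (\<phi> \<tau>) powi \<lfloor>2 * l\<rfloor>
          * ee (of_real (A$2$1) * csq B (cproj_pos B v \<zeta>) / (2 * jfac A \<tau>)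
                + of_real (A$2$1) * csq B (cproj_neg B v \<zeta>) / (2 * cnj (jfac A \<tau>)))
          * \<Phi> \<tau> \<zeta>) \<and>
     (\<forall>\<tau>\<in>uhp. cplx_holomorphic (\<Phi> \<tau>)) \<and>
     (\<exists>f. fourier_expansion L B v \<Phi> f \<and>
          (\<forall>x\<in>dual_lattice L B. linear_exp_growth_at_cusps (f x)))"


section \<open>Addition of lattices along an isomorphism\<close>

definition lattice_group :: "'a::real_normed_vector set \<Rightarrow> 'a monoid" where
  "lattice_group L = \<lparr>carrier = L, monoid.mult = (+), one = 0\<rparr>"

text \<open>The scalar extension to \<open>L \<otimes> \<real>\<close> of a homomorphism defined on \<open>L\<close>.\<close>

definition real_ext ::
  "'a::real_normed_vector set \<Rightarrow> ('a \<Rightarrow> 'b::real_normed_vector) \<Rightarrow> 'a \<Rightarrow> 'b" where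
  "real_ext L \<iota> = (THE f. linear f \<and> (\<forall>x\<in>L. f x = \<iota> x))"

text \<open>The bilinear form of \<open>L +\<^sub>\<iota> K\<close>, i.e. the one whose quadratic form \<open>x \<mapsto> (x, x) / 2\<close> is the
  sum of that of \<open>L\<close> and the pullback of that of \<open>K\<close>. The underlying group of \<open>L +\<^sub>\<iota> K\<close> is \<open>L\<close>,
  and \<open>v +\<^sub>\<iota> w\<close> is the pair \<open>v\<close> itself.\<close>

definition sum_form ::
  "'a::real_normed_vector set \<Rightarrow> ('a \<Rightarrow> 'a \<Rightarrow> real) \<Rightarrow> ('a \<Rightarrow> 'b::real_normed_vector) \<Rightarrow>
   ('b \<Rightarrow> 'b \<Rightarrow> real) \<Rightarrow> 'a \<Rightarrow> 'a \<Rightarrow> real" where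
  "sum_form L B \<iota> B' x y = B x y + B' (real_ext L \<iota> x) (real_ext L \<iota> y)"

end

theory Submission
  imports Defs
begin

text \<open>
  Transporting \<open>K\<close>, \<open>w\<close> and \<open>\<Psi>\<close> along \<open>\<iota>\<close> reduces the statement to one lattice with two forms \<open>B\<close>,
  \<open>B'\<close> that are both definite on \<open>v\<^sub>\<plusminus>\<close>; the signatures are then the dimensions of \<open>v\<^sub>\<plusminus>\<close> by Sylvester's
  law. The transformation laws multiply, since the orthogonal projections depend on \<open>v\<close> only.

  For the Fourier expansion, the terms with indices \<open>x\<close>, \<open>y\<close> of the two factors contribute to the \<open>\<rho>\<close> with
  \<open>(\<rho>, \<cdot>) = B x + B' y\<close>, and the coefficient at \<open>\<rho>\<close> is the sum of
  \<open>f\<^sub>x g\<^sub>y \<^bold>e(\<tau> q\<^sub>+ + cnj \<tau> q\<^sub>-)\<close> over all such pairs, where \<open>q\<^sub>+ \<ge> 0 \<ge> q\<^sub>-\<close> are definite quadratic in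
  \<open>x - \<rho>\<close> and \<open>y - \<rho>\<close>. By uniqueness of Fourier coefficients \<open>f\<^sub>x\<close> and \<open>g\<^sub>y\<close> depend on \<open>x\<close>, \<open>y\<close> modulo \<open>L\<close>
  only, so finitely many functions bound them all, and the remaining Gaussian sum is polynomial in
  \<open>1 / Im \<tau>\<close>. For \<open>A \<in> SL\<^sub>2(\<int>)\<close>, \<open>1 / Im (A \<tau>)\<close> grows at most linearly in \<open>Im \<tau>\<close>.
\<close>

text \<open>The fibre over \<rho> is the set of ways to write one integral functional on
  \<open>L\<close> as a sum of two, so it is infinite in positive rank. Growth of the single
  \<open>f x\<close> and \<open>g y\<close> says nothing about a sum over it, because the constants
  in \<open>linear_exp_growth_at_cusps\<close> may depend on the index; passing to classes modulo
  \<open>L\<close> is what makes them uniform. Centring \<open>x\<close> and \<open>y\<close> at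
  \<rho> completes the square: \<open>x - \<rho>\<close> and \<open>y - \<rho>\<close> represent
  opposite functionals, so the terms linear in them cancel. The Gaussian sum is delicate at cusps
  with \<open>A$2$1 \<noteq> 0\<close>, where \<open>Im (act A \<tau>)\<close> tends to 0 and the
  decay of the terms is lost; since exponential growth in \<open>y\<close> is allowed, crude
  constants are enough there. Uniqueness of coefficients is needed at one fixed \<tau> only and is
  obtained from absolute convergence and averaging over translates, without integration. The ambient
  types are merely normed spaces with a finite basis, and derivatives refer to bounded linear maps,
  so boundedness of the extension of \<iota> has to be derived from that basis.\<close>

section \<open>Finite-dimensional normed spaces\<close>

text \<open>The bound makes the coordinates of a convergent sequence Cauchy, and their limits are
  coordinates of the limit. This feeds the induction step of the next lemma.\<close>

lemma closed_span_of_coordinate_bound: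
  fixes S :: "'a::real_normed_vector set"
  assumes "finite S"
    and bd: "\<And>c x. x \<in> S \<Longrightarrow> \<bar>c x\<bar> \<le> C * norm (\<Sum>s\<in>S. c s *\<^sub>R s)"
  shows "closed (span S)"
  unfolding closed_sequential_limits
proof (intro allI impI, elim conjE)
  fix X l assume X: "\<forall>n. X n \<in> span S" and l: "X \<longlonglongrightarrow> l"
  have "\<forall>n. \<exists>u. X n = (\<Sum>s\<in>S. u s *\<^sub>R s)"
    using X unfolding span_finite[OF \<open>finite S\<close>] by blast
  then obtain u where u: "\<And>n. X n = (\<Sum>s\<in>S. u n s *\<^sub>R s)" by metis
  have "convergent (\<lambda>n. u n s)" if "s \<in> S" for s
  proof -
    have le: "\<bar>u n s - u m s\<bar> \<le> C * norm (X n - X m)" for n m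
      using bd[OF that, of "\<lambda>s. u n s - u m s"]
      by (simp add: u scaleR_left_diff_distrib sum_subtractf)
    have "Cauchy (\<lambda>n. u n s)"
    proof (rule CauchyI)
      fix e :: real assume "e > 0"
      \<comment> \<open>\<open>C\<close> may be zero or negative, hence the divisor
        \<open>\<bar>C\<bar> + 1\<close>.\<close>
      then have "e / (\<bar>C\<bar> + 1) > 0" by simp
      with LIMSEQ_imp_Cauchy[OF l] obtain M
        where M: "\<And>n m. n \<ge> M \<Longrightarrow> m \<ge> M \<Longrightarrow> norm (X n - X m) < e / (\<bar>C\<bar> + 1)"
        by (meson CauchyD)
      have "norm (u n s - u m s) < e" if "n \<ge> M" "m \<ge> M" for n m
      proof -
        have "C * norm (X n - X m) \<le> (\<bar>C\<bar> + 1) * norm (X n - X m)"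
          by (intro mult_right_mono) auto
        also have "\<dots> < (\<bar>C\<bar> + 1) * (e / (\<bar>C\<bar> + 1))"
          using M[OF that] by (intro mult_strict_left_mono) auto
        finally show ?thesis using le[of n m] by (simp add: divide_simps)
      qed
      then show "\<exists>M. \<forall>m\<ge>M. \<forall>n\<ge>M. norm (u m s - u n s) < e" by blast
    qed
    then show ?thesis by (simp add: real_Cauchy_convergent)
  qed
  then have "\<forall>s\<in>S. \<exists>c. (\<lambda>n. u n s) \<longlonglongrightarrow> c" by (simp add: convergent_def)
  then obtain c where c: "\<And>s. s \<in> S \<Longrightarrow> (\<lambda>n. u n s) \<longlonglongrightarrow> c s" by metis
  have "X \<longlonglongrightarrow> (\<Sum>s\<in>S. c s *\<^sub>R s)"
    unfolding u by (intro tendsto_intros c)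
  with l have "l = (\<Sum>s\<in>S. c s *\<^sub>R s)" by (rule LIMSEQ_unique)
  then show "l \<in> span S" by (simp add: span_sum span_scale span_base)
qed

text \<open>Equivalence of norms in finite dimension. By the bound for \<open>S\<close> its span is
  closed, so a new basis vector \<open>a\<close> keeps a distance at least \<open>d > 0\<close> from
  it. This controls the coefficient of \<open>a\<close>, and subtracting that component reduces the
  others to \<open>S\<close>.\<close>

lemma independent_coordinate_bound:
  fixes S :: "'a::real_normed_vector set"
  assumes "finite S" "independent S"
  shows "\<exists>C. \<forall>c. \<forall>x\<in>S. \<bar>c x\<bar> \<le> C * norm (\<Sum>s\<in>S. c s *\<^sub>R s)"
  using assms
proof (induction S rule: finite_induct)
  case (insert a S)
  then have "independent S" and a: "a \<notin> span S"
    by (simp_all add: independent_insert)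
  with insert obtain C where C: "\<And>c x. x \<in> S \<Longrightarrow> \<bar>c x\<bar> \<le> C * norm (\<Sum>s\<in>S. c s *\<^sub>R s)"
    by blast
  have "closed (span S)" by (rule closed_span_of_coordinate_bound[OF \<open>finite S\<close> C])
  then have "open (- span S)" by (rule open_Compl)
  with a obtain d where "d > 0" and d: "\<And>y. dist y a < d \<Longrightarrow> y \<notin> span S"
    unfolding open_dist by auto
  have da: "d * \<bar>c a\<bar> \<le> norm (\<Sum>s\<in>insert a S. c s *\<^sub>R s)" for c
  proof (cases "c a = 0")
    case False
    define y where "y = (\<Sum>s\<in>S. - (c s / c a) *\<^sub>R s)"
    have "y \<in> span S" unfolding y_def by (intro span_sum span_scale span_base)
    then have "norm (a - y) \<ge> d" using d[of y] by (force simp: dist_norm norm_minus_commute)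
    moreover have "(\<Sum>s\<in>insert a S. c s *\<^sub>R s) = c a *\<^sub>R (a - y)"
      using insert.hyps False
      by (simp add: y_def scaleR_right_distrib scaleR_sum_right sum_negf)
    ultimately show ?thesis by (simp add: mult.commute[of d] mult_left_mono)
  qed simp
  \<comment> \<open>The first entry bounds the coefficient of \<open>a\<close>. The second bounds
    the others: removing the component along \<open>a\<close> enlarges the norm by a factor of at
    most \<open>1 + norm a / d\<close>.\<close>
  define D where "D = max (1 / d) (\<bar>C\<bar> * (1 + norm a / d))"
  have "\<bar>c x\<bar> \<le> D * norm (\<Sum>s\<in>insert a S. c s *\<^sub>R s)" if "x \<in> insert a S" for c x
  proof -
    let ?n = "norm (\<Sum>s\<in>insert a S. c s *\<^sub>R s)"
    have ca: "\<bar>c a\<bar> \<le> (1 / d) * ?n"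
      using da[of c] \<open>d > 0\<close> by (simp add: field_simps)
    show ?thesis
    proof (cases "x = a")
      case True
      have "(1 / d) * ?n \<le> D * ?n" unfolding D_def by (intro mult_right_mono) auto
      with ca True show ?thesis by simp
    next
      case False
      with that have "x \<in> S" by simp
      have "(\<Sum>s\<in>S. c s *\<^sub>R s) = (\<Sum>s\<in>insert a S. c s *\<^sub>R s) - c a *\<^sub>R a"
        using insert.hyps by simp
      then have "norm (\<Sum>s\<in>S. c s *\<^sub>R s) \<le> ?n + \<bar>c a\<bar> * norm a"
        by (metis norm_scaleR norm_triangle_ineq4)
      also have "\<dots> \<le> ?n + (1 / d) * ?n * norm a"
        using ca by (intro add_left_mono mult_right_mono) auto
      also have "\<dots> = (1 + norm a / d) * ?n" by (simp add: algebra_simps)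
      finally have nS: "norm (\<Sum>s\<in>S. c s *\<^sub>R s) \<le> (1 + norm a / d) * ?n" .
      have "\<bar>c x\<bar> \<le> C * norm (\<Sum>s\<in>S. c s *\<^sub>R s)" by (rule C[OF \<open>x \<in> S\<close>])
      also have "\<dots> \<le> \<bar>C\<bar> * norm (\<Sum>s\<in>S. c s *\<^sub>R s)" by (intro mult_right_mono) auto
      also have "\<dots> \<le> \<bar>C\<bar> * ((1 + norm a / d) * ?n)" by (intro mult_left_mono nS) auto
      also have "\<dots> \<le> D * ?n" unfolding D_def mult.assoc[symmetric] by (intro mult_right_mono) auto
      finally show ?thesis .
    qed
  qed
  then show ?case by blast
qed simp

text \<open>Supplies the boundedness of the extension of \<iota>, through which smoothness and
  holomorphy are transported.\<close>

lemma linear_imp_bounded_linear_finite_span: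
  fixes f :: "'a::real_normed_vector \<Rightarrow> 'b::real_normed_vector" and S :: "'a set"
  assumes "linear f" "finite S" "independent S" "span S = UNIV"
  shows "bounded_linear f"
proof -
  obtain C where C: "\<And>c x. x \<in> S \<Longrightarrow> \<bar>c x\<bar> \<le> C * norm (\<Sum>s\<in>S. c s *\<^sub>R s)"
    using independent_coordinate_bound[OF assms(2,3)] by blast
  have "norm (f x) \<le> norm x * (\<Sum>s\<in>S. C * norm (f s))" for x
  proof -
    have "x \<in> span S" by (simp add: assms(4))
    then obtain c where c: "x = (\<Sum>s\<in>S. c s *\<^sub>R s)"
      unfolding span_finite[OF \<open>finite S\<close>] by blast
    have "f x = (\<Sum>s\<in>S. c s *\<^sub>R f s)"
      unfolding c by (simp add: linear_sum[OF assms(1)] linear_scale[OF assms(1)])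
    then have "norm (f x) \<le> (\<Sum>s\<in>S. \<bar>c s\<bar> * norm (f s))"
      by (simp add: norm_sum[THEN order_trans])
    also have "\<dots> \<le> (\<Sum>s\<in>S. (C * norm x) * norm (f s))"
      using C[of _ c] by (intro sum_mono mult_right_mono) (auto simp: c)
    finally show ?thesis by (simp add: sum_distrib_left mult_ac)
  qed
  then show ?thesis
    using assms(1) by (intro bounded_linear_intro) (auto simp: linear_add linear_scale)
qed

section \<open>Symmetric bilinear forms\<close>

lemma bilinear_sum_left:
  assumes "bilinear B"
  shows "B (\<Sum>i\<in>I. c i *\<^sub>R f i) y = (\<Sum>i\<in>I. c i *\<^sub>R B (f i) y)"
proof -
  have "linear (\<lambda>x. B x y)" using assms by (simp add: bilinear_def)
  from linear_sum[OF this, of "\<lambda>i. c i *\<^sub>R f i" I] show ?thesis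
    by (simp add: bilinear_lmul[OF assms])
qed

lemma bilinear_add:
  "bilinear B \<Longrightarrow> bilinear B' \<Longrightarrow> bilinear (\<lambda>x y. B x y + B' x y)"
  by (auto simp: bilinear_def intro!: linear_compose_add)

lemma bilinear_eq_on_span:
  assumes "bilinear B" "\<And>s. s \<in> S \<Longrightarrow> B x s = B y s" "z \<in> span S"
  shows "B x z = B y z"
  using assms linear_eq_on_span[of "B x" "B y" S z] by (auto simp: bilinear_def)

lemma orthogonal_sum_left:
  fixes B :: "'a::real_vector \<Rightarrow> 'a \<Rightarrow> real"
  assumes "bilinear B" "finite C" "\<forall>x\<in>C. \<forall>y\<in>C. x \<noteq> y \<longrightarrow> B x y = 0" "y \<in> C"
  shows "B (\<Sum>x\<in>C. c x *\<^sub>R x) y = c y * B y y"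
proof -
  have "B (\<Sum>x\<in>C. c x *\<^sub>R x) y = (\<Sum>x\<in>C. c x * B x y)"
    by (simp add: bilinear_sum_left[OF assms(1)])
  also have "\<dots> = (\<Sum>x\<in>C. if x = y then c x * B x y else 0)"
    using assms(3,4) by (intro sum.cong) auto
  finally show ?thesis using assms(2,4) by simp
qed

lemma independent_orthogonal:
  fixes B :: "'a::real_vector \<Rightarrow> 'a \<Rightarrow> real"
  assumes "bilinear B" "finite C" "\<forall>x\<in>C. \<forall>y\<in>C. x \<noteq> y \<longrightarrow> B x y = 0" "\<forall>x\<in>C. B x x \<noteq> 0"
  shows "independent C"
proof (rule independent_if_scalars_zero[OF \<open>finite C\<close>])
  fix c y assume "(\<Sum>x\<in>C. c x *\<^sub>R x) = 0" "y \<in> C"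
  then have "c y * B y y = B 0 y" using orthogonal_sum_left[OF assms(1-3)] by metis
  then show "c y = 0" using assms(4) \<open>y \<in> C\<close> bilinear_lzero[OF assms(1)] by simp
qed

text \<open>Anisotropy on the span keeps the denominators \<open>B c c\<close> nonzero, so the
  process serves positive and negative definite subspaces alike. A redundant generator leaves the
  remainder \<open>a - p = 0\<close> and is dropped.\<close>

lemma gram_schmidt_span:
  fixes B :: "'a::real_vector \<Rightarrow> 'a \<Rightarrow> real"
  assumes "finite F" "bilinear B" "\<And>x y. B x y = B y x"
    and "\<forall>x\<in>span F. x \<noteq> 0 \<longrightarrow> B x x \<noteq> 0"
  shows "\<exists>C. finite C \<and> span C = span F \<and> 0 \<notin> C \<and> (\<forall>x\<in>C. \<forall>y\<in>C. x \<noteq> y \<longrightarrow> B x y = 0)"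
  using assms(1,4)
proof (induction F rule: finite_induct)
  case empty
  show ?case by (rule exI[of _ "{}"]) simp
next
  case (insert a F)
  have "\<forall>x\<in>span F. x \<noteq> 0 \<longrightarrow> B x x \<noteq> 0"
    using insert.prems span_mono[of F "insert a F"] by blast
  then obtain C where C: "finite C" "span C = span F" "0 \<notin> C"
      "\<forall>x\<in>C. \<forall>y\<in>C. x \<noteq> y \<longrightarrow> B x y = 0"
    using insert.IH by blast
  have nz: "B c c \<noteq> 0" if "c \<in> C" for c
  proof -
    have "c \<in> span F" using C(2) that span_base by blast
    with \<open>\<forall>x\<in>span F. x \<noteq> 0 \<longrightarrow> B x x \<noteq> 0\<close> C(3) that show ?thesis by metis
  qed
  define p where "p = (\<Sum>c\<in>C. (B a c / B c c) *\<^sub>R c)"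
  have p: "p \<in> span C" unfolding p_def by (intro span_sum span_scale span_base)
  have ap: "B (a - p) c = 0" if "c \<in> C" for c
    using that nz orthogonal_sum_left[OF assms(2) C(1,4) that, of "\<lambda>c. B a c / B c c"]
    by (simp add: bilinear_lsub[OF assms(2)] p_def)
  have sp: "span (insert (a - p) C) = span (insert a F)"
  proof -
    have "span (insert (a - p) C) = span (insert a C)"
      by (rule eq_span_insert_eq) (simp add: p span_neg)
    also have "\<dots> = span (insert a F)"
      by (simp add: span_insert C(2))
    finally show ?thesis .
  qed
  show ?case
  proof (cases "a - p = 0")
    case True
    then show ?thesis using sp C by (intro exI[of _ C]) (simp add: span_insert_0)
  next
    case False
    then show ?thesis
      using sp C ap assms(3) by (intro exI[of _ "insert (a - p) C"]) auto
  qed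
qed

section \<open>Decompositions into definite subspaces\<close>

text \<open>Free of lattices, so that it can be interpreted for pulled back forms, for sums of
  forms, and for the negated form with the two halves exchanged.\<close>

locale definite_decomposition =
  fixes B :: "'a::real_normed_vector \<Rightarrow> 'a \<Rightarrow> real" and v :: "'a set \<times> 'a set"
  assumes bilinear: "bilinear B"
    and sym: "B x y = B y x"
    and Gr: "v \<in> Gr B"
begin

abbreviation "pos \<equiv> orth_proj B (fst v)"
abbreviation "neg \<equiv> orth_proj B (snd v)"

lemma subspace_fst: "subspace (fst v)" and subspace_snd: "subspace (snd v)"
  and Int_eq: "fst v \<inter> snd v = {0}"
  and decomp: "\<exists>p\<in>fst v. \<exists>n\<in>snd v. x = p + n"
  and orth: "p \<in> fst v \<Longrightarrow> n \<in> snd v \<Longrightarrow> B p n = 0"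
  and pos_definite: "p \<in> fst v \<Longrightarrow> p \<noteq> 0 \<Longrightarrow> B p p > 0"
  and neg_definite: "n \<in> snd v \<Longrightarrow> n \<noteq> 0 \<Longrightarrow> B n n < 0"
  using Gr by (auto simp: Gr_def)

lemmas form_simps = bilinear_ladd[OF bilinear] bilinear_radd[OF bilinear]
  bilinear_lsub[OF bilinear] bilinear_rsub[OF bilinear]
  bilinear_lzero[OF bilinear] bilinear_rzero[OF bilinear]
  bilinear_lmul[OF bilinear] bilinear_rmul[OF bilinear]
  bilinear_lneg[OF bilinear] bilinear_rneg[OF bilinear]

lemma orth': "n \<in> snd v \<Longrightarrow> p \<in> fst v \<Longrightarrow> B n p = 0"
  using orth sym by metis

text \<open>Uniqueness in the definite description comes from definiteness: two candidates differ by
  a vector of \<open>fst v\<close> orthogonal to itself. The value depends on the splitting alone,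
  so different forms with the same \<open>v\<close> share their projections.\<close>

lemma pos_eq:
  assumes "p \<in> fst v" "n \<in> snd v"
  shows "pos (p + n) = p"
  unfolding orth_proj_def
proof (rule the_equality)
  show "p \<in> fst v \<and> (\<forall>u\<in>fst v. B (p + n - p) u = 0)" using assms orth' by simp
next
  fix q assume q: "q \<in> fst v \<and> (\<forall>u\<in>fst v. B (p + n - q) u = 0)"
  then have pq: "p - q \<in> fst v" using assms subspace_fst by (simp add: subspace_diff)
  have "B (p - q) (p - q) = B (p + n - q) (p - q) - B n (p - q)"
    by (simp add: form_simps)
  also have "\<dots> = 0" using q pq orth'[OF assms(2) pq] by simp
  finally show "q = p" using pos_definite[OF pq] by force
qed

lemma neg_eq:
  assumes "p \<in> fst v" "n \<in> snd v"
  shows "neg (p + n) = n"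
  unfolding orth_proj_def
proof (rule the_equality)
  show "n \<in> snd v \<and> (\<forall>u\<in>snd v. B (p + n - n) u = 0)" using assms orth by simp
next
  fix q assume q: "q \<in> snd v \<and> (\<forall>u\<in>snd v. B (p + n - q) u = 0)"
  then have nq: "n - q \<in> snd v" using assms subspace_snd by (simp add: subspace_diff)
  have "B (n - q) (n - q) = B (p + n - q) (n - q) - B p (n - q)"
    by (simp add: form_simps)
  also have "\<dots> = 0" using q nq orth[OF assms(1) nq] by simp
  finally show "q = n" using neg_definite[OF nq] by force
qed

lemma pos_in [simp]: "pos x \<in> fst v" and neg_in [simp]: "neg x \<in> snd v"
  and pos_add_neg: "pos x + neg x = x"
  using decomp[of x] by (auto simp: pos_eq neg_eq)

lemma orth_pos_neg [simp]: "B (pos x) (neg y) = 0" "B (neg x) (pos y) = 0"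
  by (simp_all add: orth orth')

lemma linear_pos: "linear pos"
proof (rule linearI)
  show "pos (x + y) = pos x + pos y" for x y
  proof -
    have "pos x + neg x + (pos y + neg y) = (pos x + pos y) + (neg x + neg y)" by simp
    then have "x + y = (pos x + pos y) + (neg x + neg y)" by (simp add: pos_add_neg)
    moreover have "pos ((pos x + pos y) + (neg x + neg y)) = pos x + pos y"
      by (intro pos_eq subspace_add subspace_fst subspace_snd) auto
    ultimately show ?thesis by metis
  qed
  show "pos (c *\<^sub>R x) = c *\<^sub>R pos x" for c x
  proof -
    have "c *\<^sub>R (pos x + neg x) = c *\<^sub>R pos x + c *\<^sub>R neg x" by (rule scaleR_right_distrib)
    then have "c *\<^sub>R x = c *\<^sub>R pos x + c *\<^sub>R neg x" by (simp add: pos_add_neg)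
    moreover have "pos (c *\<^sub>R pos x + c *\<^sub>R neg x) = c *\<^sub>R pos x"
      by (intro pos_eq subspace_scale subspace_fst subspace_snd) auto
    ultimately show ?thesis by metis
  qed
qed

lemma neg_conv_pos: "neg x = x - pos x"
  by (metis pos_add_neg add_diff_cancel_left')

lemma linear_neg: "linear neg"
  unfolding neg_conv_pos[abs_def] by (intro linear_compose_sub linear_pos linear_ident)

lemma form_split: "B x y = B (pos x) (pos y) + B (neg x) (neg y)"
proof -
  have "B x y = B (pos x + neg x) (pos y + neg y)" by (simp add: pos_add_neg)
  then show ?thesis by (simp add: form_simps)
qed

lemma form_pos_pos: "B (pos x) (pos y) = B (pos x) y"
  using form_simps(2)[of "pos x" "pos y" "neg y"] by (simp add: pos_add_neg)

lemma form_neg_neg: "B (neg x) (neg y) = B (neg x) y"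
  using form_simps(2)[of "neg x" "pos y" "neg y"] by (simp add: pos_add_neg)

lemma nondegenerate:
  assumes "\<And>y. B x y = 0"
  shows "x = 0"
proof -
  have "B (pos x) (pos x) = 0" "B (neg x) (neg x) = 0"
    using assms by (metis form_pos_pos form_neg_neg sym)+
  then have "pos x = 0" "neg x = 0"
    using pos_definite[OF pos_in] neg_definite[OF neg_in] by force+
  then show ?thesis by (metis pos_add_neg add_0)
qed

lemma eq_on_spanning_set:
  assumes "span S = UNIV" "\<And>s. s \<in> S \<Longrightarrow> B x s = B y s"
  shows "x = y"
proof -
  have "B x z = B y z" for z
  proof (rule bilinear_eq_on_span[OF bilinear assms(2)])
    show "z \<in> span S" unfolding assms(1) by simp
  qed
  then have "x - y = 0" by (intro nondegenerate) (simp add: form_simps)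
  then show ?thesis by simp
qed

section \<open>Orthogonal bases and the signature\<close>

lemma orthogonal_basis_nonisotropic:
  assumes "independent S" "span S = UNIV" "\<forall>x\<in>S. \<forall>y\<in>S. x \<noteq> y \<longrightarrow> B x y = 0" "x \<in> S"
  shows "B x x \<noteq> 0"
proof
  assume "B x x = 0"
  then have "B x s = B 0 s" if "s \<in> S" for s
    using assms(3,4) that by (cases "s = x") (auto simp: form_simps)
  then have "x = 0" by (rule eq_on_spanning_set[OF assms(2)])
  with assms(1,4) show False using dependent_zero by blast
qed

text \<open>Orthogonal bases of the two halves together form an orthogonal basis of the whole space.
  The set \<open>F\<close> is what brings in finite dimension.\<close>

lemma has_signature_dim:
  fixes F :: "'a set"
  assumes "finite F" "span F = UNIV"
  shows "has_signature B (dim (fst v)) (dim (snd v))"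
proof -
  have basis: "\<exists>C. finite C \<and> span C = V \<and> independent C \<and> 0 \<notin> C \<and> (\<forall>x\<in>C. \<forall>y\<in>C. x \<noteq> y \<longrightarrow> B x y = 0)"
    if V: "subspace V" "\<forall>x\<in>V. x \<noteq> 0 \<longrightarrow> B x x \<noteq> 0" for V
  proof -
    obtain G where G: "G \<subseteq> V" "independent G" "V \<subseteq> span G"
      using basis_exists[of V] by metis
    have "finite G" using independent_span_bound[OF assms(1) G(2)] assms(2) by simp
    have sG: "span G = V" using G(1,3) span_minimal[OF G(1) V(1)] by blast
    obtain C where C: "finite C" "span C = V" "0 \<notin> C" "\<forall>x\<in>C. \<forall>y\<in>C. x \<noteq> y \<longrightarrow> B x y = 0"
      using gram_schmidt_span[OF \<open>finite G\<close> bilinear sym] V(2) sG by auto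
    have "B x x \<noteq> 0" if "x \<in> C" for x
    proof -
      have "x \<in> V" using span_base[OF that] C(2) by simp
      moreover have "x \<noteq> 0" using that C(3) by auto
      ultimately show ?thesis using V(2) by simp
    qed
    then have "independent C" by (intro independent_orthogonal[OF bilinear C(1,4)]) simp
    with C show ?thesis by (intro exI[of _ C]) simp
  qed
  obtain P where P: "finite P" "span P = fst v" "independent P" "0 \<notin> P"
      "\<forall>x\<in>P. \<forall>y\<in>P. x \<noteq> y \<longrightarrow> B x y = 0"
    using basis[OF subspace_fst] pos_definite by force
  obtain N where N: "finite N" "span N = snd v" "independent N" "0 \<notin> N"
      "\<forall>x\<in>N. \<forall>y\<in>N. x \<noteq> y \<longrightarrow> B x y = 0"
    using basis[OF subspace_snd] neg_definite by force
  have Pv: "x \<in> fst v" "B x x > 0" if "x \<in> P" for x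
    using that P(2,4) span_base[of x P] pos_definite[of x] by auto
  have Nv: "x \<in> snd v" "B x x < 0" if "x \<in> N" for x
    using that N(2,4) span_base[of x N] neg_definite[of x] by auto
  have o: "\<forall>x\<in>P \<union> N. \<forall>y\<in>P \<union> N. x \<noteq> y \<longrightarrow> B x y = 0"
    using P(5) N(5) Pv Nv orth orth' by auto
  have "B x x \<noteq> 0" if "x \<in> P \<union> N" for x
    using that Pv[of x] Nv[of x] by auto
  then have "independent (P \<union> N)"
    using P(1) N(1) by (intro independent_orthogonal[OF bilinear _ o]) auto
  moreover have "span (P \<union> N) = UNIV"
  proof -
    have "x \<in> span (P \<union> N)" for x
      using decomp[of x] P(2) N(2) by (auto simp: span_Un)
    then show ?thesis by blast
  qed
  moreover have "{x \<in> P \<union> N. B x x > 0} = P" "{x \<in> P \<union> N. B x x < 0} = N"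
    using Pv Nv by (auto simp: not_less intro: less_imp_le dest: less_asym)
  moreover have "card P = dim (fst v)" "card N = dim (snd v)"
    using dim_span_eq_card_independent[OF P(3)] dim_span_eq_card_independent[OF N(3)] P(2) N(2)
    by simp_all
  ultimately show ?thesis
    unfolding has_signature_def using o P(1) N(1) by (intro exI[of _ "P \<union> N"]) simp
qed

text \<open>Sylvester's law of inertia: projecting to \<open>v\<^sub>+\<close> is injective on any positive definite subspace.\<close>

lemma card_positive_le:
  assumes "finite A" "independent A" "\<forall>x\<in>A. \<forall>y\<in>A. x \<noteq> y \<longrightarrow> B x y = 0" "\<forall>x\<in>A. B x x > 0"
    and "finite P" "span P = fst v"
  shows "card A \<le> card P"
proof -
  have B_nonneg: "B x x \<ge> 0 \<and> (B x x = 0 \<longrightarrow> x = 0)" if x: "x \<in> span A" for x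
  proof -
    obtain c where c: "x = (\<Sum>a\<in>A. c a *\<^sub>R a)"
      using x unfolding span_finite[OF assms(1)] by blast
    have "B x x = (\<Sum>a\<in>A. c a * B x a)"
      by (subst (2) c) (simp add: bilinear_def linear_sum linear_scale bilinear[unfolded bilinear_def])
    also have "\<dots> = (\<Sum>a\<in>A. c a ^ 2 * B a a)"
      using orthogonal_sum_left[OF bilinear assms(1,3), of _ c]
      by (intro sum.cong) (auto simp: c power2_eq_square)
    finally have eq: "B x x = (\<Sum>a\<in>A. c a ^ 2 * B a a)" .
    have nn: "\<And>a. a \<in> A \<Longrightarrow> c a ^ 2 * B a a \<ge> 0" using assms(4) by (simp add: less_imp_le)
    have "x = 0" if "B x x = 0"
    proof -
      have "\<forall>a\<in>A. c a ^ 2 * B a a = 0"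
        using that sum_nonneg_eq_0_iff[OF assms(1) nn] unfolding eq by simp
      then have "\<forall>a\<in>A. c a = 0" using assms(4) by fastforce
      then show ?thesis by (simp add: c)
    qed
    with nn show ?thesis unfolding eq by (simp add: sum_nonneg)
  qed
  have inj: "inj_on pos (span A)"
    unfolding linear_injective_on_subspace_0[OF linear_pos subspace_span]
  proof (intro ballI impI)
    \<comment> \<open>A vector killed by \<open>pos\<close> lies in \<open>snd v\<close>, where
      nonzero vectors have negative square, while no vector of \<open>span A\<close> has negative
      square.\<close>
    fix x assume x: "x \<in> span A" "pos x = 0"
    then have "x = neg x" by (metis pos_add_neg add_0)
    then have "x \<in> snd v" by (metis neg_in)
    with B_nonneg[OF x(1)] show "x = 0" using neg_definite[of x] by force
  qed
  have indep: "independent (pos ` A)"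
    by (rule linear_independent_injective_image[OF linear_pos assms(2) inj])
  have "pos ` A \<subseteq> span P" by (simp add: image_subset_iff assms(6))
  from independent_span_bound[OF assms(5) indep this]
  have "card (pos ` A) \<le> card P" by (rule conjunct2)
  moreover have "card (pos ` A) = card A"
    using inj by (intro card_image inj_on_subset[OF inj span_superset])
  ultimately show ?thesis by simp
qed

end

text \<open>Turns statements about the positive half into statements about the negative
  half.\<close>

lemma definite_decomposition_uminus:
  assumes "definite_decomposition B v"
  shows "definite_decomposition (\<lambda>x y. - B x y) (snd v, fst v)"
proof -
  interpret definite_decomposition B v by fact
  show ?thesis
  proof
    show "bilinear (\<lambda>x y. - B x y)"
      using bilinear by (auto simp: bilinear_def intro: linear_compose_neg)
    show "- B x y = - B y x" for x y using sym by metis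
    have "\<exists>p\<in>snd v. \<exists>n\<in>fst v. x = p + n" for x
      using decomp[of x] by (metis add.commute)
    moreover have "snd v \<inter> fst v = {0}" using Int_eq by blast
    ultimately show "(snd v, fst v) \<in> Gr (\<lambda>x y. - B x y)"
      unfolding Gr_def using subspace_fst subspace_snd orth' pos_definite neg_definite by auto
  qed
qed

text \<open>The bound on positive definite subspaces, for \<open>B\<close> and for
  \<open>- B\<close>, gives \<open>p \<le> dim (fst v)\<close> and
  \<open>q \<le> dim (snd v)\<close>. An orthogonal basis has no isotropic member, so
  \<open>p + q\<close> is the full dimension and both inequalities are equalities.\<close>

lemma (in definite_decomposition) has_signature_unique:
  assumes "has_signature B p q"
  shows "p = dim (fst v)" "q = dim (snd v)"
proof -
  obtain S where S: "finite S" "independent S" "span S = UNIV"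
      "\<forall>x\<in>S. \<forall>y\<in>S. x \<noteq> y \<longrightarrow> B x y = 0"
      "card {x\<in>S. B x x > 0} = p" "card {x\<in>S. B x x < 0} = q"
    using assms unfolding has_signature_def by blast
  obtain T where T: "finite T" "independent T" "span T = UNIV"
      "\<forall>x\<in>T. \<forall>y\<in>T. x \<noteq> y \<longrightarrow> B x y = 0"
      "card {x\<in>T. B x x > 0} = dim (fst v)" "card {x\<in>T. B x x < 0} = dim (snd v)"
    using has_signature_dim[OF S(1,3)] unfolding has_signature_def by blast
  have split: "card S' = card {x\<in>S'. B x x > 0} + card {x\<in>S'. B x x < 0}"
    if "finite S'" "\<forall>x\<in>S'. B x x \<noteq> 0" for S'
  proof -
    have "S' = {x\<in>S'. B x x > 0} \<union> {x\<in>S'. B x x < 0}"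
      using that(2) by (auto simp: neq_iff)
    then show ?thesis
      using that(1) by (metis (no_types, lifting) card_Un_disjoint disjoint_iff finite_Un
          mem_Collect_eq order_less_asym)
  qed
  have "card S = card T"
    using independent_span_bound[OF S(1) T(2)] independent_span_bound[OF T(1) S(2)] S(3) T(3)
    by simp
  then have sum: "p + q = dim (fst v) + dim (snd v)"
    using split[OF S(1)] split[OF T(1)] orthogonal_basis_nonisotropic[OF S(2-4)]
      orthogonal_basis_nonisotropic[OF T(2-4)] S(5,6) T(5,6) by simp
  have basis: "\<exists>P. finite P \<and> span P = V \<and> card P = dim V"
    if "subspace V" for V :: "'a set"
  proof -
    obtain G where G: "G \<subseteq> V" "independent G" "V \<subseteq> span G" "card G = dim V"
      using basis_exists[of V] by metis
    moreover have "finite G" using independent_span_bound[OF S(1) G(2)] S(3) by simp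
    moreover have "span G = V" using G(1,3) span_minimal[OF G(1) that] by blast
    ultimately show ?thesis by blast
  qed
  obtain P where P: "finite P" "span P = fst v" "card P = dim (fst v)"
    using basis[OF subspace_fst] by blast
  obtain N where N: "finite N" "span N = snd v" "card N = dim (snd v)"
    using basis[OF subspace_snd] by blast
  interpret m: definite_decomposition "\<lambda>x y. - B x y" "(snd v, fst v)"
    by (rule definite_decomposition_uminus) unfold_locales
  have ind: "independent {x\<in>S. R x}" for R using S(2) by (rule independent_mono) auto
  have "card {x\<in>S. B x x > 0} \<le> card P"
    by (rule card_positive_le[OF _ ind _ _ P(1,2)]) (use S(1,4) in simp_all)
  moreover have "card {x\<in>S. B x x < 0} \<le> card N"
    by (rule m.card_positive_le[OF _ ind _ _ N(1)]) (use S(1,4) N(2) in simp_all)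
  ultimately show "p = dim (fst v)" "q = dim (snd v)" using sum S(5,6) P(3) N(3) by linarith+
qed

section \<open>Smooth functions\<close>

text \<open>The recursion differentiates \<open>frechet_derivative f (at x) h\<close> as a function
  of \<open>x\<close>, but formulas for it are known only on \<open>S\<close>. For open
  \<open>S\<close> the derivatives on \<open>S\<close> depend on the values there alone.\<close>

lemma times_differentiable_on_cong:
  assumes "open S" "\<And>x. x \<in> S \<Longrightarrow> f x = g x" "times_differentiable_on n S f"
  shows "times_differentiable_on n S g"
  using assms(2,3)
proof (induction n arbitrary: f g)
  case 0
  then show ?case by (simp cong: continuous_on_cong)
next
  case (Suc n)
  have D: "(g has_derivative frechet_derivative f (at x)) (at x)" if "x \<in> S" for x
  proof (rule has_derivative_transform_within_open[OF _ assms(1) that])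
    show "(f has_derivative frechet_derivative f (at x)) (at x)"
      using Suc.prems(2) that by (simp add: frechet_derivative_works)
  qed (use Suc.prems(1) in auto)
  then have "g differentiable at x" if "x \<in> S" for x
    using that by (auto simp: differentiable_def)
  moreover have "times_differentiable_on n S (\<lambda>x. frechet_derivative g (at x) h)" for h
  proof (rule Suc.IH)
    show "frechet_derivative f (at x) h = frechet_derivative g (at x) h" if "x \<in> S" for x
      using frechet_derivative_at[OF D[OF that]] by simp
    show "times_differentiable_on n S (\<lambda>x. frechet_derivative f (at x) h)"
      using Suc.prems(2) by simp
  qed
  ultimately show ?case by simp
qed

lemma times_differentiable_on_add:
  assumes "open S" "times_differentiable_on n S f" "times_differentiable_on n S g"
  shows "times_differentiable_on n S (\<lambda>x. f x + g x)"
  using assms(2,3)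
proof (induction n arbitrary: f g)
  case 0
  then show ?case by (simp add: continuous_on_add)
next
  case (Suc n)
  have D: "((\<lambda>x. f x + g x) has_derivative
      (\<lambda>h. frechet_derivative f (at x) h + frechet_derivative g (at x) h)) (at x)" if "x \<in> S" for x
    using Suc.prems that by (intro has_derivative_add) (auto simp: frechet_derivative_works)
  have "times_differentiable_on n S (\<lambda>x. frechet_derivative (\<lambda>x. f x + g x) (at x) h)" for h
  proof (rule times_differentiable_on_cong[OF assms(1)])
    show "times_differentiable_on n S
        (\<lambda>x. frechet_derivative f (at x) h + frechet_derivative g (at x) h)"
      using Suc by simp
  qed (simp add: frechet_derivative_at[OF D, symmetric])
  with D show ?case by (auto simp: differentiable_def)
qed

text \<open>The product rule pairs each factor with the derivative of the other, so the induction
  needs the undifferentiated factor again at order \<open>n\<close>. Assuming smoothness of both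
  factors throughout, instead of order \<open>n\<close>, provides it.\<close>

lemma smooth_on_mult:
  fixes f g :: "'a::real_normed_vector \<Rightarrow> 'b::real_normed_algebra"
  assumes "open S" "smooth_on S f" "smooth_on S g"
  shows "smooth_on S (\<lambda>x. f x * g x)"
  unfolding smooth_on_def
proof
  fix n show "times_differentiable_on n S (\<lambda>x. f x * g x)"
    using assms(2,3)
  proof (induction n arbitrary: f g)
    case 0
    then have "times_differentiable_on 0 S f" "times_differentiable_on 0 S g"
      unfolding smooth_on_def by blast+
    then show ?case by (simp add: continuous_on_mult)
  next
    case (Suc n)
    have sm: "times_differentiable_on (Suc m) S f" "times_differentiable_on (Suc m) S g" for m
      using Suc.prems unfolding smooth_on_def by blast+
    have D: "((\<lambda>x. f x * g x) has_derivative
        (\<lambda>h. f x * frechet_derivative g (at x) h + frechet_derivative f (at x) h * g x)) (at x)"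
      if "x \<in> S" for x
      using sm that by (intro has_derivative_mult) (auto simp: frechet_derivative_works)
    have "times_differentiable_on n S (\<lambda>x. frechet_derivative (\<lambda>x. f x * g x) (at x) h)" for h
    proof (rule times_differentiable_on_cong[OF assms(1)])
      have "smooth_on S (\<lambda>x. frechet_derivative f (at x) h)"
           "smooth_on S (\<lambda>x. frechet_derivative g (at x) h)"
        unfolding smooth_on_def using sm by auto
      then show "times_differentiable_on n S
          (\<lambda>x. f x * frechet_derivative g (at x) h + frechet_derivative f (at x) h * g x)"
        using Suc by (intro times_differentiable_on_add[OF assms(1)]) auto
    qed (simp add: frechet_derivative_at[OF D, symmetric])
    with D show ?case by (auto simp: differentiable_def)
  qed
qed

text \<open>The derivative of the composite in direction \<open>h\<close> is the derivative of
  \<open>f\<close> in the fixed direction \<open>T h\<close>, composed with \<open>T\<close>. It has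
  the same shape, so the induction closes.\<close>

lemma smooth_on_compose_bounded_linear:
  assumes "bounded_linear T" "open R" "T ` R \<subseteq> S" "smooth_on S f"
  shows "smooth_on R (\<lambda>x. f (T x))"
  unfolding smooth_on_def
proof
  fix n
  have "times_differentiable_on n S f" using assms(4) unfolding smooth_on_def by blast
  then show "times_differentiable_on n R (\<lambda>x. f (T x))"
  proof (induction n arbitrary: f)
    case 0
    then show ?case
      using assms(3) linear_continuous_on[OF assms(1)] by (auto intro: continuous_on_compose2)
  next
    case (Suc n)
    have D: "((\<lambda>x. f (T x)) has_derivative (\<lambda>h. frechet_derivative f (at (T x)) (T h))) (at x)"
      if "x \<in> R" for x
      using that Suc.prems assms(3)
      by (intro has_derivative_compose[OF bounded_linear_imp_has_derivative[OF assms(1)]])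
        (auto simp: frechet_derivative_works)
    have "times_differentiable_on n R (\<lambda>x. frechet_derivative (\<lambda>x. f (T x)) (at x) h)" for h
    proof (rule times_differentiable_on_cong[OF assms(2)])
      show "times_differentiable_on n R (\<lambda>x. frechet_derivative f (at (T x)) (T h))"
        using Suc.IH[of "\<lambda>y. frechet_derivative f (at y) (T h)"] Suc.prems by simp
    qed (simp add: frechet_derivative_at[OF D, symmetric])
    with D show ?case by (auto simp: differentiable_def)
  qed
qed

section \<open>Holomorphic functions on the complexification\<close>

lemma cplx_holomorphic_mult:
  assumes "cplx_holomorphic f" "cplx_holomorphic g"
  shows "cplx_holomorphic (\<lambda>\<zeta>. f \<zeta> * g \<zeta>)"
  unfolding cplx_holomorphic_def
proof
  fix \<zeta>
  obtain F G where "(f has_derivative F) (at \<zeta>)" "\<forall>c z. F (cscale c z) = c * F z"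
    "(g has_derivative G) (at \<zeta>)" "\<forall>c z. G (cscale c z) = c * G z"
    using assms unfolding cplx_holomorphic_def by metis
  then show "\<exists>D. ((\<lambda>\<zeta>. f \<zeta> * g \<zeta>) has_derivative D) (at \<zeta>) \<and> (\<forall>c z. D (cscale c z) = c * D z)"
    by (intro exI[of _ "\<lambda>h. f \<zeta> * G h + F h * g \<zeta>"] conjI has_derivative_mult)
      (auto simp: algebra_simps)
qed

lemma
  assumes "linear T"
  shows cext_cscale: "cext T (cscale c z) = cscale c (cext T z)"
    and cext_add: "cext T (z + w) = cext T z + cext T w"
    and cext_of_lat: "cext T (of_lat x) = of_lat (T x)"
  by (simp_all only: cext_def cscale_def of_lat_def plus_prod_def fst_conv snd_conv
      linear_add[OF assms] linear_diff[OF assms] linear_scale[OF assms] linear_0[OF assms])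

lemma bounded_linear_cext:
  assumes "bounded_linear T"
  shows "bounded_linear (cext T)"
  unfolding cext_def
  by (rule bounded_linear_Pair bounded_linear_compose[OF assms bounded_linear_fst]
      bounded_linear_compose[OF assms bounded_linear_snd])+

lemma cplx_holomorphic_compose_cext:
  assumes "cplx_holomorphic f" "bounded_linear T"
  shows "cplx_holomorphic (\<lambda>\<zeta>. f (cext T \<zeta>))"
  unfolding cplx_holomorphic_def
proof
  fix \<zeta>
  obtain F where F: "(f has_derivative F) (at (cext T \<zeta>))" "\<forall>c z. F (cscale c z) = c * F z"
    using assms(1) unfolding cplx_holomorphic_def by metis
  have "(cext T has_derivative cext T) (at \<zeta>)"
    by (intro bounded_linear_imp_has_derivative bounded_linear_cext assms(2))
  from has_derivative_compose[where f = "cext T" and g = f, OF this F(1)]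
  have "((\<lambda>\<zeta>. f (cext T \<zeta>)) has_derivative (\<lambda>h. F (cext T h))) (at \<zeta>)" .
  moreover have "F (cext T (cscale c z)) = c * F (cext T z)" for c z
    using F(2) cext_cscale[OF bounded_linear.linear[OF assms(2)]] by metis
  ultimately show "\<exists>D. ((\<lambda>\<zeta>. f (cext T \<zeta>)) has_derivative D) (at \<zeta>) \<and>
      (\<forall>c z. D (cscale c z) = c * D z)" by blast
qed

section \<open>Extending homomorphisms of lattices\<close>

text \<open>Closure under subtraction is the subgroup criterion. It is applied to the set of lattice
  points where a linear map agrees with a given homomorphism.\<close>

lemma int_combination_in:
  fixes S Q :: "'a::real_vector set"
  assumes "finite S" "S \<subseteq> Q" "0 \<in> Q" "\<And>x y. x \<in> Q \<Longrightarrow> y \<in> Q \<Longrightarrow> x - y \<in> Q"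
  shows "(\<Sum>s\<in>S. of_int (c s) *\<^sub>R s) \<in> Q"
proof -
  have minus: "- x \<in> Q" if "x \<in> Q" for x using assms(4)[OF assms(3) that] by simp
  have add: "x + y \<in> Q" if "x \<in> Q" "y \<in> Q" for x y
    using assms(4)[OF that(1) minus[OF that(2)]] by simp
  have nat: "of_nat n *\<^sub>R x \<in> Q" if "x \<in> Q" for n x
    by (induction n) (auto simp: assms(3) scaleR_left_distrib add that)
  have "of_int k *\<^sub>R x \<in> Q" if "x \<in> Q" for k x
    using nat[OF that, of "nat k"] minus[OF nat[OF that, of "nat (- k)"]]
    by (cases "k \<ge> 0") auto
  then have "of_int (c s) *\<^sub>R s \<in> Q" if "s \<in> S" for s using assms(2) that by blast
  then show ?thesis
    using assms(1) by (induction S rule: infinite_finite_induct) (auto simp: assms(3) intro!: add)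
qed

lemma free_latticeE:
  assumes "free_lattice L"
  obtains S where "finite S" "independent S" "span S = UNIV" "S \<subseteq> L"
    "L = {\<Sum>x\<in>S. of_int (c x) *\<^sub>R x | c. True}"
    "0 \<in> L" "\<And>x y. x \<in> L \<Longrightarrow> y \<in> L \<Longrightarrow> x - y \<in> L" "\<And>x y. x \<in> L \<Longrightarrow> y \<in> L \<Longrightarrow> x + y \<in> L"
proof -
  obtain S where S: "finite S" "independent S" "span S = UNIV"
      and L: "L = {\<Sum>x\<in>S. of_int (c x) *\<^sub>R x | c. True}"
    using assms unfolding free_lattice_def by blast
  have I: "(\<Sum>x\<in>S. of_int (c x) *\<^sub>R x) \<in> L" for c unfolding L by blast
  have "s \<in> L" if "s \<in> S" for s
  proof -
    have "(\<Sum>x\<in>S. of_int (if x = s then 1 else 0) *\<^sub>R x) = (\<Sum>x\<in>S. if x = s then x else 0)"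
      by (intro sum.cong) auto
    also have "\<dots> = s" using S(1) that by simp
    finally show ?thesis using I by metis
  qed
  then have "S \<subseteq> L" by blast
  moreover have "0 \<in> L" using I[of "\<lambda>_. 0"] by simp
  moreover have "x - y \<in> L \<and> x + y \<in> L" if xy: "x \<in> L" "y \<in> L" for x y
  proof -
    obtain c d where cd: "x = (\<Sum>x\<in>S. of_int (c x) *\<^sub>R x)" "y = (\<Sum>x\<in>S. of_int (d x) *\<^sub>R x)"
      using xy unfolding L by blast
    have "x - y = (\<Sum>x\<in>S. of_int (c x - d x) *\<^sub>R x)" "x + y = (\<Sum>x\<in>S. of_int (c x + d x) *\<^sub>R x)"
      unfolding cd by (simp_all add: scaleR_left_diff_distrib scaleR_left_distrib sum_subtractf sum.distrib)
    then show ?thesis using I by metis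
  qed
  ultimately show ?thesis using that[OF S _ L] by blast
qed

lemma linear_eq_on_lattice:
  assumes "free_lattice L" "linear f" "linear g" "\<And>x. x \<in> L \<Longrightarrow> f x = g x"
  shows "f = g"
proof -
  obtain S where "span S = UNIV" "S \<subseteq> L" using free_latticeE[OF assms(1)] by metis
  then show ?thesis using linear_eq_on_span[OF assms(2,3), of S] assms(4) by blast
qed

text \<open>Extend linearly from a lattice basis: the lattice points where the extension agrees with
  \<iota> form a subgroup containing the basis, hence all of \<open>L\<close>. Uniqueness holds
  because \<open>L\<close> spans, so the definite description is meaningful.\<close>

lemma real_ext_props:
  assumes "free_lattice L" "\<And>x y. x \<in> L \<Longrightarrow> y \<in> L \<Longrightarrow> \<iota> (x + y) = \<iota> x + \<iota> y"
  shows "linear (real_ext L \<iota>)" "x \<in> L \<Longrightarrow> real_ext L \<iota> x = \<iota> x"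
proof -
  obtain S where S: "finite S" "independent S" "S \<subseteq> L"
    and L: "L = {\<Sum>x\<in>S. of_int (c x) *\<^sub>R x | c. True}"
    and cl: "0 \<in> L" "\<And>x y. x \<in> L \<Longrightarrow> y \<in> L \<Longrightarrow> x - y \<in> L"
    by (rule free_latticeE[OF assms(1)]) blast
  obtain f where f: "linear f" "\<forall>x\<in>S. f x = \<iota> x"
    using linear_independent_extend[OF S(2)] by blast
  let ?Q = "{x\<in>L. f x = \<iota> x}"
  have diff: "\<iota> (x - y) = \<iota> x - \<iota> y" if "x \<in> L" "y \<in> L" for x y
    using assms(2)[of "x - y" y] cl(2) that by simp
  have "\<iota> 0 = 0" using diff[OF cl(1) cl(1)] by simp
  then have "(\<Sum>s\<in>S. of_int (c s) *\<^sub>R s) \<in> ?Q" for c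
    using S f cl by (intro int_combination_in) (auto simp: linear_0 linear_diff diff)
  then have eq: "\<forall>x\<in>L. f x = \<iota> x" unfolding L by auto
  have "\<exists>!f. linear f \<and> (\<forall>x\<in>L. f x = \<iota> x)"
  proof (intro ex1I[of _ f] conjI f(1) eq)
    fix g assume "linear g \<and> (\<forall>x\<in>L. g x = \<iota> x)"
    then show "g = f" using eq by (intro linear_eq_on_lattice[OF assms(1) _ f(1)]) auto
  qed
  from theI'[OF this] show "linear (real_ext L \<iota>)" "x \<in> L \<Longrightarrow> real_ext L \<iota> x = \<iota> x"
    unfolding real_ext_def by auto
qed

text \<open>The inverse is the extension of the inverse homomorphism: both composites fix a spanning
  lattice pointwise.\<close>

lemma real_ext_iso:
  assumes "free_lattice L" "free_lattice K" "\<iota> \<in> iso (lattice_group L) (lattice_group K)"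
  obtains "linear (real_ext L \<iota>)" "bij (real_ext L \<iota>)" "real_ext L \<iota> ` L = K"
proof -
  let ?T = "real_ext L \<iota>"
  have hom: "\<iota> (x + y) = \<iota> x + \<iota> y" if "x \<in> L" "y \<in> L" for x y
    using assms(3) that by (auto simp: iso_def hom_def lattice_group_def)
  have bij: "bij_betw \<iota> L K" using assms(3) by (auto simp: iso_def lattice_group_def)
  have T: "linear ?T" "\<And>x. x \<in> L \<Longrightarrow> ?T x = \<iota> x"
    using real_ext_props[of L \<iota>, OF assms(1)] hom by auto
  define \<kappa> where "\<kappa> = inv_into L \<iota>"
  have \<kappa>L: "\<kappa> x \<in> L" if "x \<in> K" for x
    using bij that unfolding \<kappa>_def bij_betw_def by (metis inv_into_into)
  have \<iota>\<kappa>: "\<iota> (\<kappa> x) = x" if "x \<in> K" for x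
    using bij that unfolding \<kappa>_def by (rule bij_betw_inv_into_right)
  have \<kappa>\<iota>: "\<kappa> (\<iota> x) = x" if "x \<in> L" for x
    using bij that unfolding \<kappa>_def by (rule bij_betw_inv_into_left)
  have hom': "\<kappa> (x + y) = \<kappa> x + \<kappa> y" if "x \<in> K" "y \<in> K" for x y
  proof -
    have "\<kappa> x + \<kappa> y \<in> L" using \<kappa>L that free_latticeE[OF assms(1)] by metis
    moreover have "\<iota> (\<kappa> x + \<kappa> y) = x + y" using hom \<kappa>L \<iota>\<kappa> that by simp
    ultimately show ?thesis using \<kappa>\<iota> by metis
  qed
  let ?U = "real_ext K \<kappa>"
  have U: "linear ?U" "\<And>x. x \<in> K \<Longrightarrow> ?U x = \<kappa> x"
    using real_ext_props[of K \<kappa>, OF assms(2)] hom' by auto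
  have \<iota>K: "\<iota> x \<in> K" if "x \<in> L" for x using bij that by (rule bij_betwE[rule_format])
  have "(?U \<circ> ?T) x = id x" if "x \<in> L" for x
    using T(2)[OF that] U(2)[OF \<iota>K[OF that]] \<kappa>\<iota>[OF that] by simp
  then have "?U \<circ> ?T = id"
    by (rule linear_eq_on_lattice[OF assms(1) linear_compose[OF T(1) U(1)] linear_id])
  moreover have "(?T \<circ> ?U) x = id x" if "x \<in> K" for x
    using U(2)[OF that] T(2)[OF \<kappa>L[OF that]] \<iota>\<kappa>[OF that] by simp
  then have "?T \<circ> ?U = id"
    by (rule linear_eq_on_lattice[OF assms(2) linear_compose[OF U(1) T(1)] linear_id])
  ultimately have "bij ?T" by (rule o_bij)
  moreover have "?T ` L = K"
    using bij T(2) unfolding bij_betw_def by (metis image_cong)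
  ultimately show ?thesis using T(1) that by blast
qed

section \<open>Transport of structure\<close>

abbreviation (input) pullback :: "('a \<Rightarrow> 'b) \<Rightarrow> ('b \<Rightarrow> 'b \<Rightarrow> real) \<Rightarrow> 'a \<Rightarrow> 'a \<Rightarrow> real" where
  "pullback T B \<equiv> \<lambda>x y. B (T x) (T y)"

lemma bilinear_pullback:
  assumes "bilinear B" "linear T"
  shows "bilinear (pullback T B)"
  unfolding bilinear_def
proof (intro conjI allI)
  show "linear (\<lambda>y. B (T x) (T y))" for x
    using linear_compose[OF assms(2), of "B (T x)"] assms(1) by (simp add: bilinear_def o_def)
  show "linear (\<lambda>x. B (T x) (T y))" for y
    using linear_compose[OF assms(2), of "\<lambda>x. B x (T y)"] assms(1) by (simp add: bilinear_def o_def)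
qed

lemma definite_decomposition_pullback:
  assumes "definite_decomposition B w" "linear T" "bij T" "T ` fst v = fst w" "T ` snd v = snd w"
  shows "definite_decomposition (pullback T B) v"
proof -
  interpret w: definite_decomposition B w by fact
  note inj = bij_is_inj[OF assms(3)]
  have v: "fst v = T -` fst w" "snd v = T -` snd w"
    using assms(4,5) inj by (metis inj_vimage_image_eq)+
  have nz: "T x \<noteq> 0" if "x \<noteq> 0" for x
    using that injD[OF inj, of x 0] linear_0[OF assms(2)] by auto
  have "\<exists>p\<in>fst v. \<exists>n\<in>snd v. x = p + n" for x
  proof -
    obtain p' n' where pn': "p' \<in> T ` fst v" "n' \<in> T ` snd v" "T x = p' + n'"
      using w.decomp[of "T x"] unfolding assms(4,5) by blast
    then obtain p n where pn: "p \<in> fst v" "n \<in> snd v" "T x = T p + T n" by blast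
    then have "T x = T (p + n)" by (simp add: linear_add[OF assms(2)])
    then have "x = p + n" by (rule injD[OF inj])
    with pn show ?thesis by blast
  qed
  moreover have "fst v \<inter> snd v = {0}"
    using w.Int_eq nz linear_0[OF assms(2)] unfolding v by auto
  moreover have "subspace (fst v)" "subspace (snd v)"
    unfolding v by (intro linear_subspace_vimage assms(2) w.subspace_fst w.subspace_snd)+
  ultimately have "v \<in> Gr (pullback T B)"
    unfolding Gr_def
    using v w.orth w.pos_definite w.neg_definite nz linear_0[OF assms(2)]
      subspace_0[OF w.subspace_fst] subspace_0[OF w.subspace_snd] by auto
  then show ?thesis
    using bilinear_pullback[OF w.bilinear assms(2)] w.sym by unfold_locales
qed

text \<open>On each half the two forms have the same sign, so no cancellation can occur. This is
  where compatibility of \<iota> with the decompositions enters.\<close>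

lemma definite_decomposition_add:
  assumes "definite_decomposition B v" "definite_decomposition B' v"
  shows "definite_decomposition (\<lambda>x y. B x y + B' x y) v"
proof -
  interpret B: definite_decomposition B v by fact
  interpret B': definite_decomposition B' v by fact
  have "v \<in> Gr (\<lambda>x y. B x y + B' x y)"
    unfolding Gr_def
    using B.subspace_fst B.subspace_snd B.Int_eq B.decomp B.orth B'.orth
      B.pos_definite B'.pos_definite B.neg_definite B'.neg_definite
    by (auto simp: add_pos_pos add_neg_neg)
  then show ?thesis
    using bilinear_add[OF B.bilinear B'.bilinear] B.sym B'.sym by unfold_locales metis+
qed

text \<open>The inverse of \<open>T\<close> carries an orthogonal basis for \<open>B\<close> to one
  for the pulled back form, with the same squares.\<close>

lemma has_signature_pullback:
  assumes "has_signature B p q" "linear T" "bij T"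
  shows "has_signature (pullback T B) p q"
proof -
  obtain S where S: "finite S" "independent S" "span S = UNIV"
      "\<forall>x\<in>S. \<forall>y\<in>S. x \<noteq> y \<longrightarrow> B x y = 0"
      "card {x\<in>S. B x x > 0} = p" "card {x\<in>S. B x x < 0} = q"
    using assms(1) unfolding has_signature_def by blast
  define U where "U = inv_into UNIV T"
  have TU: "T (U x) = x" for x
    unfolding U_def using bij_is_surj[OF assms(3)] by (rule surj_f_inv_f)
  have UT: "U (T x) = x" for x
    unfolding U_def using bij_is_inj[OF assms(3)] by (rule inv_f_f)
  have inj: "inj U" by (metis TU injI)
  have lin: "linear U"
  proof (rule linearI)
    show "U (x + y) = U x + U y" for x y
      using UT[of "U x + U y"] by (simp add: linear_add[OF assms(2)] TU)
    show "U (c *\<^sub>R x) = c *\<^sub>R U x" for c x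
      using UT[of "c *\<^sub>R U x"] by (simp add: linear_scale[OF assms(2)] TU)
  qed
  have card: "card {x \<in> U ` S. R (T x)} = card {x \<in> S. R x}" for R
  proof -
    have "{x \<in> U ` S. R (T x)} = U ` {x \<in> S. R x}" by (auto simp: TU)
    then show ?thesis by (simp add: card_image inj_on_subset[OF inj])
  qed
  have "independent (U ` S)"
    by (rule linear_independent_injective_image[OF lin S(2)]) (rule inj_on_subset[OF inj], simp)
  moreover have "span (U ` S) = UNIV"
  proof -
    have "span (U ` S) = range U" using linear_span_image[OF lin, of S] S(3) by simp
    also have "\<dots> = UNIV" using UT by (rule surjI)
    finally show ?thesis .
  qed
  moreover have "\<forall>x\<in>U ` S. \<forall>y\<in>U ` S. x \<noteq> y \<longrightarrow> B (T x) (T y) = 0"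
    using S(4) by (auto simp: TU)
  ultimately show ?thesis
    unfolding has_signature_def
    using S(1,5,6) card[of "\<lambda>x. B x x > 0"] card[of "\<lambda>x. B x x < 0"]
    by (intro exI[of _ "U ` S"]) simp
qed

section \<open>Even lattices and Jacobi forms under pullback and sum\<close>

lemma even_latticeD:
  assumes "even_lattice L B"
  shows "free_lattice L" "bilinear B" "B x y = B y x"
    and "x \<in> L \<Longrightarrow> y \<in> L \<Longrightarrow> B x y \<in> \<int>"
    and "x \<in> L \<Longrightarrow> \<exists>n::int. B x x = 2 * of_int n"
proof -
  note E = assms[unfolded even_lattice_def]
  show "free_lattice L" "bilinear B" "B x y = B y x" using E by (elim conjE, iprover)+
  have "\<forall>x\<in>L. \<forall>y\<in>L. B x y \<in> \<int>" "\<forall>x\<in>L. \<exists>n::int. B x x = 2 * of_int n"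
    using E by auto
  then show "x \<in> L \<Longrightarrow> y \<in> L \<Longrightarrow> B x y \<in> \<int>" "x \<in> L \<Longrightarrow> \<exists>n::int. B x x = 2 * of_int n"
    by simp_all
qed

lemma even_lattice_definite_decomposition:
  assumes "even_lattice L B" "v \<in> Gr B"
  shows "definite_decomposition B v"
  using even_latticeD(2,3)[OF assms(1)] assms(2) by unfold_locales

lemma even_lattice_pullback:
  assumes "even_lattice (T ` L) B" "free_lattice L" "linear T" "bij T"
  shows "even_lattice L (pullback T B)"
proof -
  have "x = 0" if "x \<in> L" "\<forall>y\<in>L. B (T x) (T y) = 0" for x
  proof -
    have "T x = 0" using assms(1) that unfolding even_lattice_def by simp
    then show ?thesis using linear_0[OF assms(3)] injD[OF bij_is_inj[OF assms(4)], of x 0] by simp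
  qed
  then show ?thesis
    using assms bilinear_pullback[OF _ assms(3)] unfolding even_lattice_def by simp
qed

text \<open>A sum of nondegenerate forms can degenerate in general; here the common decomposition
  \<open>v\<close> prevents it. Integrality and evenness simply add.\<close>

lemma even_lattice_add:
  assumes "even_lattice L B" "even_lattice L B'" "v \<in> Gr B" "v \<in> Gr B'"
  shows "even_lattice L (\<lambda>x y. B x y + B' x y)"
proof -
  interpret M: definite_decomposition "\<lambda>x y. B x y + B' x y" v
    by (rule definite_decomposition_add[OF even_lattice_definite_decomposition[OF assms(1,3)]
          even_lattice_definite_decomposition[OF assms(2,4)]])
  have free: "free_lattice L" using assms(1) by (simp add: even_lattice_def)
  obtain S where S: "span S = UNIV" "S \<subseteq> L" by (rule free_latticeE[OF free]) blast
  have even: "\<exists>n::int. B x x + B' x x = 2 * of_int n" if x: "x \<in> L" for x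
  proof -
    obtain m n :: int where "B x x = 2 * of_int m" "B' x x = 2 * of_int n"
      using even_latticeD(5)[OF assms(1) x] even_latticeD(5)[OF assms(2) x] by blast
    then show ?thesis by (intro exI[of _ "m + n"]) simp
  qed
  have nondeg: "x = 0" if "\<forall>y\<in>L. B x y + B' x y = 0" for x
  proof -
    have "B x y + B' x y = B 0 y + B' 0 y" for y
      using bilinear_eq_on_span[OF M.bilinear, of S x 0 y] S that M.form_simps(5) by auto
    then show ?thesis using M.nondegenerate M.form_simps(5) by simp
  qed
  have int: "B x y + B' x y \<in> \<int>" if "x \<in> L" "y \<in> L" for x y
    using even_latticeD(4)[OF assms(1) that] even_latticeD(4)[OF assms(2) that] by simp
  show ?thesis
    unfolding even_lattice_def using free M.bilinear M.sym int even nondeg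
    by (intro conjI allI ballI impI) auto
qed

lemma cform_pullback: "cform (pullback T B) z z' = cform B (cext T z) (cext T z')"
  by (simp add: cform_def cext_def)

text \<open>\<open>T\<close> intertwines the projections, because it respects the halves and the
  splitting of a vector is unique, and it maps the dual lattice of the pulled back form bijectively
  onto that of \<open>B\<close>. Each clause is then the clause for \<Phi> at
  \<open>cext T \<zeta>\<close>.\<close>

lemma jacobi_form_pullback:
  fixes T :: "'a::real_normed_vector \<Rightarrow> 'b::real_normed_vector"
  assumes "definite_decomposition B w" "linear T" "bij T" "bounded_linear T"
    and v: "T ` fst v = fst w" "T ` snd v = snd w"
    and "jacobi_form \<Gamma> k l (T ` L) B w \<Phi>"
  shows "jacobi_form \<Gamma> k l L (pullback T B) v (\<lambda>\<tau> \<zeta>. \<Phi> \<tau> (cext T \<zeta>))"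
proof -
  interpret w: definite_decomposition B w by fact
  interpret v: definite_decomposition "pullback T B" v
    by (rule definite_decomposition_pullback[OF assms(1-3) v])
  have "T (v.pos x) = w.pos (T x) \<and> T (v.neg x) = w.neg (T x)" for x
  proof -
    have "T (v.pos x) \<in> fst w" "T (v.neg x) \<in> snd w"
      using imageI[OF v.pos_in[of x], of T] imageI[OF v.neg_in[of x], of T] unfolding v .
    note eqs = w.pos_eq[OF this] w.neg_eq[OF this]
    have "T x = T (v.pos x) + T (v.neg x)"
      unfolding linear_add[OF assms(2), symmetric] v.pos_add_neg ..
    then show ?thesis by (simp only: eqs)
  qed
  then have proj: "cext T (cext v.pos \<zeta>) = cext w.pos (cext T \<zeta>)"
    "cext T (cext v.neg \<zeta>) = cext w.neg (cext T \<zeta>)" for \<zeta>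
    by (simp_all add: cext_def)
  note simps = cform_pullback proj cext_cscale[OF assms(2)] cext_add[OF assms(2)]
    cext_of_lat[OF assms(2)]
  note J = assms(7)[unfolded jacobi_form_def]
  have "bounded_linear (\<lambda>z::complex \<times> 'a cplx. (fst z, cext T (snd z)))"
    by (rule bounded_linear_Pair bounded_linear_fst
        bounded_linear_compose[OF bounded_linear_cext[OF assms(4)] bounded_linear_snd])+
  moreover have "open (uhp \<times> UNIV :: (complex \<times> 'a cplx) set)"
    unfolding uhp_def by (intro open_Times open_halfspace_Im_gt open_UNIV)
  moreover have "(\<lambda>z. (fst z, cext T (snd z))) ` (uhp \<times> UNIV) \<subseteq> uhp \<times> UNIV" by auto
  moreover have "smooth_on (uhp \<times> UNIV) (\<lambda>(\<tau>, \<zeta>). \<Phi> \<tau> \<zeta>)" using J by (rule conjunct1)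
  ultimately have "smooth_on (uhp \<times> UNIV) (\<lambda>z. (\<lambda>(\<tau>, \<zeta>). \<Phi> \<tau> \<zeta>) (fst z, cext T (snd z)))"
    by (rule smooth_on_compose_bounded_linear)
  then have "smooth_on (uhp \<times> UNIV) (\<lambda>(\<tau>, \<zeta>). \<Phi> \<tau> (cext T \<zeta>))"
    by (simp add: case_prod_beta')
  moreover have "\<forall>\<tau>\<in>uhp. cplx_holomorphic (\<lambda>\<zeta>. \<Phi> \<tau> (cext T \<zeta>))"
    using J cplx_holomorphic_compose_cext[OF _ assms(4)] by blast
  moreover obtain f where f: "fourier_expansion (T ` L) B w \<Phi> f"
      "\<forall>x\<in>dual_lattice (T ` L) B. linear_exp_growth_at_cusps (f x)"
    using J by blast
  have "dual_lattice L (pullback T B) = T -` dual_lattice (T ` L) B"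
    by (auto simp: dual_lattice_def)
  then have bij: "bij_betw T (dual_lattice L (pullback T B)) (dual_lattice (T ` L) B)"
    using bij_is_inj[OF assms(3)] bij_is_surj[OF assms(3)]
    by (simp add: bij_betw_def surj_image_vimage_eq inj_on_subset[OF _ subset_UNIV])
  have "fourier_expansion L (pullback T B) v (\<lambda>\<tau> \<zeta>. \<Phi> \<tau> (cext T \<zeta>)) (\<lambda>x. f (T x))"
    unfolding fourier_expansion_def simps
  proof (intro ballI allI)
    fix \<tau> \<zeta> assume "\<tau> \<in> uhp"
    then have "((\<lambda>x. f x \<tau> * ee (\<tau> * csq B (cext w.pos (of_lat x)) / 2
        + cnj \<tau> * csq B (cext w.neg (of_lat x)) / 2 + cform B (of_lat x) (cext T \<zeta>)))
        has_sum \<Phi> \<tau> (cext T \<zeta>)) (dual_lattice (T ` L) B)"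
      using f(1) unfolding fourier_expansion_def by blast
    then show "((\<lambda>x. f (T x) \<tau> * ee (\<tau> * csq B (cext w.pos (of_lat (T x))) / 2
        + cnj \<tau> * csq B (cext w.neg (of_lat (T x))) / 2 + cform B (of_lat (T x)) (cext T \<zeta>)))
        has_sum \<Phi> \<tau> (cext T \<zeta>)) (dual_lattice L (pullback T B))"
      unfolding has_sum_reindex_bij_betw[OF bij, symmetric] .
  qed
  moreover have "\<forall>x\<in>dual_lattice L (pullback T B). linear_exp_growth_at_cusps (f (T x))"
    using f(2) bij by (auto simp: bij_betw_def)
  moreover have "\<forall>\<tau>\<in>uhp. \<forall>\<zeta>. \<forall>\<sigma>\<in>L. \<forall>\<nu>\<in>L.
      \<Phi> \<tau> (cext T (\<zeta> + cscale \<tau> (cext v.pos (of_lat \<sigma>))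
        + cscale (cnj \<tau>) (cext v.neg (of_lat \<sigma>)) + of_lat \<nu>))
      = ee (- \<tau> * csq (pullback T B) (cext v.pos (of_lat \<sigma>)) / 2
        - cnj \<tau> * csq (pullback T B) (cext v.neg (of_lat \<sigma>)) / 2
        - cform (pullback T B) (of_lat \<sigma>) \<zeta>) * \<Phi> \<tau> (cext T \<zeta>)"
    unfolding simps
  proof (intro ballI allI)
    fix \<tau> \<zeta> \<sigma> \<nu> assume "\<tau> \<in> uhp" "\<sigma> \<in> L" "\<nu> \<in> L"
    from J[THEN conjunct2, THEN conjunct1, rule_format, OF this(1) imageI[OF this(2)] imageI[OF this(3)]]
    show "\<Phi> \<tau> (cext T \<zeta> + cscale \<tau> (cext w.pos (of_lat (T \<sigma>)))
        + cscale (cnj \<tau>) (cext w.neg (of_lat (T \<sigma>))) + of_lat (T \<nu>))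
      = ee (- \<tau> * csq B (cext w.pos (of_lat (T \<sigma>))) / 2
        - cnj \<tau> * csq B (cext w.neg (of_lat (T \<sigma>))) / 2
        - cform B (of_lat (T \<sigma>)) (cext T \<zeta>)) * \<Phi> \<tau> (cext T \<zeta>)" .
  qed
  moreover have "\<forall>\<tau>\<in>uhp. \<forall>\<zeta>. \<forall>(A, \<phi>)\<in>\<Gamma>.
      \<Phi> (act A \<tau>) (cext T (cscale (1 / jfac A \<tau>) (cext v.pos \<zeta>)
        + cscale (1 / cnj (jfac A \<tau>)) (cext v.neg \<zeta>)))
      = \<phi> \<tau> powi \<lfloor>2 * k\<rfloor> * cnj (\<phi> \<tau>) powi \<lfloor>2 * l\<rfloor>
        * ee (of_real (A$2$1) * csq (pullback T B) (cext v.pos \<zeta>) / (2 * jfac A \<tau>)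
          + of_real (A$2$1) * csq (pullback T B) (cext v.neg \<zeta>) / (2 * cnj (jfac A \<tau>)))
        * \<Phi> \<tau> (cext T \<zeta>)"
    unfolding simps
    by (intro ballI allI) (rule J[THEN conjunct2, THEN conjunct2, THEN conjunct1, rule_format])
  ultimately show ?thesis
    unfolding jacobi_form_def by blast
qed

section \<open>Exponential sums\<close>

lemma ee_add: "ee (z + w) = ee z * ee w"
  by (simp add: ee_def exp_add ring_distribs)

lemma ee_0 [simp]: "ee 0 = 1"
  by (simp add: ee_def)

lemma ee_nonzero [simp]: "ee z \<noteq> 0"
  by (simp add: ee_def)

lemma norm_ee: "norm (ee z) = exp (- 2 * pi * Im z)"
  by (simp add: ee_def norm_exp_eq_Re)

text \<open>Summability of complex families is absolute summability, which passes to the product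
  family; the double sum may then be evaluated iteratedly.\<close>

lemma has_sum_mult_Times:
  fixes f :: "'i \<Rightarrow> complex" and g :: "'j \<Rightarrow> complex"
  assumes f: "(f has_sum a) I" and g: "(g has_sum b) J"
  shows "((\<lambda>(i, j). f i * g j) has_sum a * b) (I \<times> J)"
proof (rule has_sum_SigmaI)
  show "((\<lambda>j. case (i, j) of (i, j) \<Rightarrow> f i * g j) has_sum f i * b) J" for i
    using has_sum_cmult_right[OF g] by simp
  show "((\<lambda>i. f i * b) has_sum a * b) I" by (rule has_sum_cmult_left[OF f])
  have norm: "(\<lambda>i. norm (f i)) summable_on I" "(\<lambda>j. norm (g j)) summable_on J"
    using has_sum_imp_summable[OF f] has_sum_imp_summable[OF g]
    by (simp_all only: summable_on_iff_abs_summable_on_complex)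
  have "(\<lambda>z. norm (case z of (i, j) \<Rightarrow> f i * g j)) summable_on I \<times> J"
    unfolding Infinite_Sum.abs_summable_on_Sigma_iff
  proof (intro conjI ballI)
    show "(\<lambda>j. norm (case (i, j) of (i, j) \<Rightarrow> f i * g j)) summable_on J" for i
      using summable_on_cmult_right[OF norm(2), of "norm (f i)"] by (simp add: norm_mult)
    show "(\<lambda>i. norm (\<Sum>\<^sub>\<infinity>j\<in>J. norm (case (i, j) of (i, j) \<Rightarrow> f i * g j))) summable_on I"
      using summable_on_cmult_left[OF norm(1), of "\<Sum>\<^sub>\<infinity>j\<in>J. norm (g j)"]
      by (simp add: norm_mult infsum_cmult_right' abs_mult infsum_nonneg)
  qed
  then show "(\<lambda>(i, j). f i * g j) summable_on I \<times> J" by (rule Infinite_Sum.abs_summable_summable)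
qed

text \<open>Averaging a function of \<open>\<xi>\<close> over two suitably rotated translates keeps the coefficient at
  \<open>x0\<close>, does not increase the others, and can be made to kill any given one.\<close>

lemma exponential_sum_filter:
  fixes B :: "'a::real_normed_vector \<Rightarrow> 'a \<Rightarrow> real"
  assumes "bilinear B" and nondeg: "\<And>x. x \<noteq> 0 \<Longrightarrow> \<exists>y. B x y \<noteq> 0"
    and sum: "\<And>\<xi>. ((\<lambda>x. a x * ee (of_real (B x \<xi>))) has_sum 0) D"
    and "finite G" "x0 \<notin> G"
  shows "\<exists>m. m x0 = 1 \<and> (\<forall>x. norm (m x) \<le> 1) \<and> (\<forall>x\<in>G. m x = 0) \<and>
    (\<forall>\<xi>. ((\<lambda>x. a x * m x * ee (of_real (B x \<xi>))) has_sum 0) D)"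
  using assms(4,5)
proof (induction G rule: finite_induct)
  case empty
  show ?case by (rule exI[of _ "\<lambda>_. 1"]) (simp add: sum)
next
  case (insert g G)
  then obtain m where m: "m x0 = 1" "\<And>x. norm (m x) \<le> 1" "\<And>x. x \<in> G \<Longrightarrow> m x = 0"
      "\<And>\<xi>. ((\<lambda>x. a x * m x * ee (of_real (B x \<xi>))) has_sum 0) D" by auto
  from insert.prems have "g - x0 \<noteq> 0" by auto
  then obtain y0 where y0: "B (g - x0) y0 \<noteq> 0" using nondeg by blast
  \<comment> \<open>Scaled so that the character takes the value \<open>ee (1 / 2) = -1\<close> at
    \<open>g - x0\<close>. The factor \<open>(1 + ee (B (x - x0) y)) / 2\<close> is then 0 at
    \<open>g\<close>, 1 at \<open>x0\<close> and of norm at most 1 everywhere.\<close>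
  define y where "y = (1 / (2 * B (g - x0) y0)) *\<^sub>R y0"
  have y: "B (g - x0) y = 1 / 2" using y0 by (simp add: y_def bilinear_rmul[OF assms(1)])
  define m' where "m' x = m x * ((1 + ee (of_real (B (x - x0) y))) / 2)" for x
  have half: "ee (1 / 2) = -1" by (simp add: ee_def mult.commute)
  have "m' x0 = 1" using m(1) by (simp add: m'_def bilinear_lzero[OF assms(1)])
  moreover have "norm (m' x) \<le> 1" for x
  proof -
    have "norm (1 + ee (of_real (B (x - x0) y))) \<le> norm (1::complex) + norm (ee (of_real (B (x - x0) y)))"
      by (rule norm_triangle_ineq)
    also have "\<dots> = 2" by (simp add: norm_ee)
    finally have "norm ((1 + ee (of_real (B (x - x0) y))) / 2) \<le> 1" by (simp add: norm_divide)
    then show ?thesis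
      using mult_mono[OF m(2)[of x]] unfolding m'_def norm_mult by fastforce
  qed
  moreover have "m' x = 0" if "x \<in> insert g G" for x
    using that m(3)[of x] by (cases "x = g") (simp_all add: m'_def y half)
  moreover have "((\<lambda>x. a x * m' x * ee (of_real (B x \<xi>))) has_sum 0) D" for \<xi>
  proof -
    \<comment> \<open>The mean of the relation at \<xi> and of the relation at
      \<open>\<xi> + y\<close> rotated by \<open>ee (- B x0 y)\<close>; both sums are 0.\<close>
    have "((\<lambda>x. (1 / 2) * (a x * m x * ee (of_real (B x \<xi>)))
        + (ee (- of_real (B x0 y)) / 2) * (a x * m x * ee (of_real (B x (\<xi> + y))))) has_sum
        (1 / 2) * 0 + (ee (- of_real (B x0 y)) / 2) * 0) D"
      by (intro has_sum_add has_sum_cmult_right m(4))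
    moreover have "(1 / 2) * (a x * m x * ee (of_real (B x \<xi>)))
        + (ee (- of_real (B x0 y)) / 2) * (a x * m x * ee (of_real (B x (\<xi> + y))))
        = a x * m' x * ee (of_real (B x \<xi>))" for x
    proof -
      have "ee (of_real (B (x - x0) y)) * ee (of_real (B x \<xi>))
          = ee (- of_real (B x0 y)) * ee (of_real (B x (\<xi> + y)))"
        unfolding ee_add[symmetric]
        by (simp add: bilinear_lsub[OF assms(1)] bilinear_radd[OF assms(1)] add_ac)
      then show ?thesis unfolding m'_def by algebra
    qed
    ultimately show ?thesis by simp
  qed
  ultimately show ?case by blast
qed

text \<open>Choose a finite \<open>F\<close> containing \<open>x0\<close> outside which the norms
  sum to less than \<open>norm (a x0)\<close>. Filtering out \<open>F - {x0}\<close> leaves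
  \<open>a x0\<close> plus a remainder of smaller norm, which cannot add up to 0.\<close>

lemma exponential_sum_eq_0:
  fixes B :: "'a::real_normed_vector \<Rightarrow> 'a \<Rightarrow> real"
  assumes "bilinear B" "\<And>x. x \<noteq> 0 \<Longrightarrow> \<exists>y. B x y \<noteq> 0"
    and sum: "\<And>\<xi>. ((\<lambda>x. a x * ee (of_real (B x \<xi>))) has_sum 0) D"
    and "x0 \<in> D"
  shows "a x0 = 0"
proof (rule ccontr)
  assume "a x0 \<noteq> 0"
  then have pos: "norm (a x0) > 0" by simp
  have "a summable_on D"
    using has_sum_imp_summable[OF sum[of 0]] by (simp add: bilinear_rzero[OF assms(1)])
  then have abs: "(\<lambda>x. norm (a x)) summable_on D"
    by (simp add: summable_on_iff_abs_summable_on_complex)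
  define s where "s = infsum (\<lambda>x. norm (a x)) D"
  have s: "((\<lambda>x. norm (a x)) has_sum s) D" unfolding s_def using abs by (rule has_sum_infsum)
  then have "\<forall>\<^sub>F F in finite_subsets_at_top D. dist (\<Sum>x\<in>F. norm (a x)) s < norm (a x0)"
    unfolding has_sum_def using pos by (rule tendstoD)
  then obtain F0 where F0: "finite F0" "F0 \<subseteq> D"
    "\<forall>F. finite F \<and> F0 \<subseteq> F \<and> F \<subseteq> D \<longrightarrow> dist (\<Sum>x\<in>F. norm (a x)) s < norm (a x0)"
    unfolding eventually_finite_subsets_at_top by auto
  define F where "F = insert x0 F0"
  have F: "finite F" "F \<subseteq> D" using F0 assms(4) by (auto simp: F_def)
  have "finite (F - {x0})" using F by simp
  then obtain m where m: "m x0 = 1" "\<And>x. norm (m x) \<le> 1" "\<And>x. x \<in> F - {x0} \<Longrightarrow> m x = 0"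
      "\<And>\<xi>. ((\<lambda>x. a x * m x * ee (of_real (B x \<xi>))) has_sum 0) D"
    using exponential_sum_filter[OF assms(1-3), of "F - {x0}" x0] by auto
  have am: "((\<lambda>x. a x * m x) has_sum 0) D"
    using m(4)[of 0] by (simp add: bilinear_rzero[OF assms(1)])
  have "(\<Sum>x\<in>F. a x * m x) = (\<Sum>x\<in>F. if x = x0 then a x else 0)"
    using m(1,3) by (intro sum.cong) auto
  also have "\<dots> = a x0" using F by (simp add: F_def)
  finally have "((\<lambda>x. a x * m x) has_sum (0 - a x0)) (D - F)"
    using has_sum_Diff[OF am has_sum_finite[OF F(1)] F(2)] by simp
  moreover have "((\<lambda>x. norm (a x)) has_sum (s - (\<Sum>x\<in>F. norm (a x)))) (D - F)"
    by (rule has_sum_Diff[OF s has_sum_finite[OF F(1)] F(2)])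
  moreover have "norm (a x * m x) \<le> norm (a x)" for x
    using m(2)[of x] by (simp add: norm_mult mult_left_le)
  ultimately have "norm (0 - a x0) \<le> s - (\<Sum>x\<in>F. norm (a x))"
    by (rule norm_infsum_le)
  moreover have "dist (\<Sum>x\<in>F. norm (a x)) s < norm (a x0)"
    using F0(3) F by (auto simp: F_def)
  ultimately show False by (simp add: dist_real_def)
qed

section \<open>Gaussian sums\<close>

text \<open>The correction term makes the induction telescope: with \<open>m = N + 1\<close>, the
  two new terms are at most \<open>4 / (m * (m + 1))\<close>. Equality at \<open>N = 0\<close> fixes
  the constant 5.\<close>

lemma sum_inverse_Suc_square_le: "(\<Sum>j\<in>{- int N..int N}. 1 / (1 + (of_int j)\<^sup>2)) \<le> 5 - 4 / (real N + 1)"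
proof (induction N)
  case (Suc N)
  have "{- int (Suc N)..int (Suc N)} = insert (- int (Suc N)) (insert (int (Suc N)) {- int N..int N})"
    by auto
  then have "(\<Sum>j\<in>{- int (Suc N)..int (Suc N)}. 1 / (1 + (of_int j)\<^sup>2))
      = 2 * (1 / (1 + (real N + 1)\<^sup>2)) + (\<Sum>j\<in>{- int N..int N}. 1 / (1 + (of_int j)\<^sup>2))"
    by (simp add: power2_eq_square algebra_simps)
  moreover have "2 * (1 / (1 + (real N + 1)\<^sup>2)) \<le> 4 / (real N + 1) - 4 / (real (Suc N) + 1)"
    by (simp add: divide_simps power2_eq_square algebra_simps add_pos_nonneg)
  ultimately show ?case using Suc.IH by linarith
qed simp

text \<open>Exponential decay is traded for quadratic decay,
  \<open>exp (- b * u\<^sup>2) \<le> (1 + 1 / b) / (1 + u\<^sup>2)\<close>. Replacing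
  \<open>u\<close> by the integer \<open>k - \<lfloor>r\<rfloor>\<close> costs a factor 3 and the
  remaining sum is at most 5, whence 15, uniformly in \<open>r\<close> and \<open>T\<close>.\<close>

lemma sum_gaussian_int_le:
  fixes b r :: real
  assumes "b > 0" "finite T"
  shows "(\<Sum>k\<in>T. exp (- b * (of_int k - r)\<^sup>2)) \<le> 15 * (1 + 1 / b)"
proof -
  have "exp (- b * (of_int k - r)\<^sup>2) \<le> 3 * (1 + 1 / b) * (1 / (1 + (of_int (k - \<lfloor>r\<rfloor>))\<^sup>2))" for k :: int
  proof -
    define u where "u = of_int k - r"
    define j :: real where "j = of_int (k - \<lfloor>r\<rfloor>)"
    \<comment> \<open>The difference \<open>j - u\<close> is the fractional part of
      \<open>r\<close>.\<close>
    have "\<bar>j - u\<bar> \<le> 1" unfolding j_def u_def by simp linarith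
    then have "(j - u)\<^sup>2 \<le> 1" by (simp add: abs_square_le_1)
    moreover have "j\<^sup>2 \<le> 2 * u\<^sup>2 + 2 * (j - u)\<^sup>2"
      using zero_le_power2[of "2 * u - j"] by (simp add: power2_eq_square algebra_simps)
    ultimately have "j\<^sup>2 \<le> 2 * u\<^sup>2 + 2 * 1"
      by (meson add_left_mono mult_left_mono order_trans zero_le_numeral)
    then have j: "1 + j\<^sup>2 \<le> 3 * (1 + u\<^sup>2)" by (smt (verit) zero_le_power2)
    have frac: "1 / p \<le> c / q" if "0 < p" "0 < q" "q \<le> c * p" for p q c :: real
      using that by (simp add: pos_divide_le_eq pos_le_divide_eq)
    have "exp (- (b * u\<^sup>2)) = 1 / exp (b * u\<^sup>2)" by (simp add: exp_minus inverse_eq_divide)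
    also have "\<dots> \<le> (1 + 1 / b) / (1 + u\<^sup>2)"
    proof (rule frac)
      have "1 + u\<^sup>2 \<le> (1 + 1 / b) * (1 + b * u\<^sup>2)"
        using assms(1) by (simp add: distrib_left distrib_right)
      also have "\<dots> \<le> (1 + 1 / b) * exp (b * u\<^sup>2)"
        using assms(1) by (intro mult_left_mono exp_ge_add_one_self) simp
      finally show "1 + u\<^sup>2 \<le> (1 + 1 / b) * exp (b * u\<^sup>2)" .
    qed (simp_all add: add_pos_nonneg)
    also have "\<dots> \<le> (1 + 1 / b) * (3 / (1 + j\<^sup>2))"
    proof -
      have "1 / (1 + u\<^sup>2) \<le> 3 / (1 + j\<^sup>2)"
        using j by (intro frac) (simp_all add: add_pos_nonneg)
      from mult_left_mono[OF this, of "1 + 1 / b"] show ?thesis using assms(1) by simp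
    qed
    finally show ?thesis by (simp add: u_def j_def mult_ac)
  qed
  then have "(\<Sum>k\<in>T. exp (- b * (of_int k - r)\<^sup>2))
      \<le> (\<Sum>k\<in>T. 3 * (1 + 1 / b) * (1 / (1 + (of_int (k - \<lfloor>r\<rfloor>))\<^sup>2)))"
    by (intro sum_mono)
  also have "\<dots> = 3 * (1 + 1 / b) * (\<Sum>j\<in>(\<lambda>k. k - \<lfloor>r\<rfloor>) ` T. 1 / (1 + (of_int j)\<^sup>2))"
    by (subst sum.reindex) (auto simp: inj_on_def sum_distrib_left)
  also have "\<dots> \<le> 3 * (1 + 1 / b) * 5"
  proof (rule mult_left_mono)
    define J where "J = (\<lambda>k. k - \<lfloor>r\<rfloor>) ` T"
    define N where "N = nat (Max (insert 0 (abs ` J)))"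
    have "finite J" using assms(2) by (simp add: J_def)
    then have "\<bar>j\<bar> \<le> int N" if "j \<in> J" for j
      using that by (auto simp: N_def intro!: Max_ge)
    then have "J \<subseteq> {- int N..int N}" by force
    then have "(\<Sum>j\<in>J. 1 / (1 + (of_int j)\<^sup>2)) \<le> (\<Sum>j\<in>{- int N..int N}. 1 / (1 + (of_int j :: real)\<^sup>2))"
      by (intro sum_mono2) auto
    also have "\<dots> \<le> 5 - 4 / (real N + 1)" by (rule sum_inverse_Suc_square_le)
    also have "\<dots> \<le> 5" by simp
    finally show "(\<Sum>j\<in>J. 1 / (1 + (of_int j :: real)\<^sup>2)) \<le> 5" .
  qed (use assms(1) in simp)
  finally show ?thesis by simp
qed

section \<open>Growth at the cusps\<close>

lemma SL2_det: "A \<in> SL2R \<Longrightarrow> A$1$1 * A$2$2 - A$1$2 * A$2$1 = 1"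
  by (simp add: SL2R_def det_2)

lemma jfac_nonzero:
  assumes "A \<in> SL2R" "\<tau> \<in> uhp"
  shows "jfac A \<tau> \<noteq> 0"
proof
  assume 0: "jfac A \<tau> = 0"
  then have "A$2$1 * Im \<tau> = 0" "A$2$1 * Re \<tau> + A$2$2 = 0"
    by (auto simp: jfac_def complex_eq_iff)
  then show False using SL2_det[OF assms(1)] assms(2) by (auto simp: uhp_def)
qed

lemma Im_act:
  assumes "A \<in> SL2R" "\<tau> \<in> uhp"
  shows "Im (act A \<tau>) = Im \<tau> / (cmod (jfac A \<tau>))\<^sup>2"
proof -
  have "Im (act A \<tau>) = (A$1$1 * A$2$2 - A$1$2 * A$2$1) * Im \<tau> / (cmod (jfac A \<tau>))\<^sup>2"
    unfolding act_def moebius_def jfac_def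
    by (simp add: Im_divide cmod_power2 algebra_simps)
  then show ?thesis using SL2_det[OF assms(1)] by simp
qed

lemma act_in_uhp: "A \<in> SL2R \<Longrightarrow> \<tau> \<in> uhp \<Longrightarrow> act A \<tau> \<in> uhp"
  using Im_act jfac_nonzero by (simp add: uhp_def)

lemma linear_exp_growth_mono:
  assumes "linear_exp_growth_at_cusps g" "\<And>\<tau>. \<tau> \<in> uhp \<Longrightarrow> norm (f \<tau>) \<le> norm (g \<tau>)"
  shows "linear_exp_growth_at_cusps f"
  unfolding linear_exp_growth_at_cusps_def
proof
  fix A assume A: "A \<in> SL2Z"
  then obtain C where C: "\<And>X. bounded X \<Longrightarrow>
      \<exists>M. \<forall>\<^sub>F y in at_top. \<forall>x\<in>X. norm (g (act A (Complex x y))) \<le> M * exp (C * y)"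
    using assms(1) unfolding linear_exp_growth_at_cusps_def by blast
  have "\<exists>M. \<forall>\<^sub>F y in at_top. \<forall>x\<in>X. norm (f (act A (Complex x y))) \<le> M * exp (C * y)"
    if X: "bounded X" for X
  proof -
    obtain M where "\<forall>\<^sub>F y in at_top. \<forall>x\<in>X. norm (g (act A (Complex x y))) \<le> M * exp (C * y)"
      using C[OF X] by blast
    then have "\<forall>\<^sub>F y in at_top. \<forall>x\<in>X. norm (f (act A (Complex x y))) \<le> M * exp (C * y)"
      using eventually_gt_at_top[of 0]
    proof eventually_elim
      case (elim y)
      have "norm (f (act A (Complex x y))) \<le> norm (g (act A (Complex x y)))" for x
        using A elim(2) by (intro assms(2) act_in_uhp) (auto simp: SL2Z_def uhp_def)
      with elim(1) show ?case by (meson order_trans)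
    qed
    then show ?thesis by blast
  qed
  then show "\<exists>C. \<forall>X. bounded X \<longrightarrow>
      (\<exists>M. \<forall>\<^sub>F y in at_top. \<forall>x\<in>X. norm (f (act A (Complex x y))) \<le> M * exp (C * y))" by blast
qed

lemma linear_exp_growth_add:
  assumes "linear_exp_growth_at_cusps f" "linear_exp_growth_at_cusps g"
  shows "linear_exp_growth_at_cusps (\<lambda>\<tau>. f \<tau> + g \<tau>)"
  unfolding linear_exp_growth_at_cusps_def
proof
  fix A assume A: "A \<in> SL2Z"
  obtain C where C: "\<And>X. bounded X \<Longrightarrow>
      \<exists>M. \<forall>\<^sub>F y in at_top. \<forall>x\<in>X. norm (f (act A (Complex x y))) \<le> M * exp (C * y)"
    using assms(1) A unfolding linear_exp_growth_at_cusps_def by blast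
  obtain D where D: "\<And>X. bounded X \<Longrightarrow>
      \<exists>M. \<forall>\<^sub>F y in at_top. \<forall>x\<in>X. norm (g (act A (Complex x y))) \<le> M * exp (D * y)"
    using assms(2) A unfolding linear_exp_growth_at_cusps_def by blast
  have "\<exists>M. \<forall>\<^sub>F y in at_top. \<forall>x\<in>X.
      norm (f (act A (Complex x y)) + g (act A (Complex x y))) \<le> M * exp (max C D * y)"
    if X: "bounded X" for X
  proof -
    obtain M N where
      M: "\<forall>\<^sub>F y in at_top. \<forall>x\<in>X. norm (f (act A (Complex x y))) \<le> M * exp (C * y)" and
      N: "\<forall>\<^sub>F y in at_top. \<forall>x\<in>X. norm (g (act A (Complex x y))) \<le> N * exp (D * y)"
      using C[OF X] D[OF X] by blast
    \<comment> \<open>For empty \<open>X\<close> the constants \<open>M\<close> and \<open>N\<close>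
      may be negative, hence the absolute values. Passing to \<open>max C D\<close> in the exponent
      requires \<open>y \<ge> 0\<close>.\<close>
    from M N eventually_ge_at_top[of 0]
    have "\<forall>\<^sub>F y in at_top. \<forall>x\<in>X. norm (f (act A (Complex x y)) + g (act A (Complex x y)))
        \<le> (\<bar>M\<bar> + \<bar>N\<bar>) * exp (max C D * y)"
    proof eventually_elim
      case (elim y)
      show ?case
      proof
        fix x assume x: "x \<in> X"
        have "norm (f (act A (Complex x y)) + g (act A (Complex x y)))
            \<le> M * exp (C * y) + N * exp (D * y)"
          using elim(1,2) x by (intro norm_triangle_mono) auto
        also have "\<dots> \<le> \<bar>M\<bar> * exp (max C D * y) + \<bar>N\<bar> * exp (max C D * y)"
          using elim(3) by (intro add_mono mult_mono) (auto intro!: mult_right_mono)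
        finally show "norm (f (act A (Complex x y)) + g (act A (Complex x y)))
            \<le> (\<bar>M\<bar> + \<bar>N\<bar>) * exp (max C D * y)" by (simp add: ring_distribs)
      qed
    qed
    then show ?thesis by blast
  qed
  then show "\<exists>C. \<forall>X. bounded X \<longrightarrow> (\<exists>M. \<forall>\<^sub>F y in at_top. \<forall>x\<in>X.
      norm (f (act A (Complex x y)) + g (act A (Complex x y))) \<le> M * exp (C * y))" by blast
qed

lemma linear_exp_growth_mult:
  assumes "linear_exp_growth_at_cusps f" "linear_exp_growth_at_cusps g"
  shows "linear_exp_growth_at_cusps (\<lambda>\<tau>. f \<tau> * g \<tau>)"
  unfolding linear_exp_growth_at_cusps_def
proof
  fix A assume A: "A \<in> SL2Z"
  obtain C where C: "\<And>X. bounded X \<Longrightarrow>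
      \<exists>M. \<forall>\<^sub>F y in at_top. \<forall>x\<in>X. norm (f (act A (Complex x y))) \<le> M * exp (C * y)"
    using assms(1) A unfolding linear_exp_growth_at_cusps_def by blast
  obtain D where D: "\<And>X. bounded X \<Longrightarrow>
      \<exists>M. \<forall>\<^sub>F y in at_top. \<forall>x\<in>X. norm (g (act A (Complex x y))) \<le> M * exp (D * y)"
    using assms(2) A unfolding linear_exp_growth_at_cusps_def by blast
  have "\<exists>M. \<forall>\<^sub>F y in at_top. \<forall>x\<in>X.
      norm (f (act A (Complex x y)) * g (act A (Complex x y))) \<le> M * exp ((C + D) * y)"
    if X: "bounded X" for X
  proof -
    obtain M N where
      M: "\<forall>\<^sub>F y in at_top. \<forall>x\<in>X. norm (f (act A (Complex x y))) \<le> M * exp (C * y)" and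
      N: "\<forall>\<^sub>F y in at_top. \<forall>x\<in>X. norm (g (act A (Complex x y))) \<le> N * exp (D * y)"
      using C[OF X] D[OF X] by blast
    from M N
    have "\<forall>\<^sub>F y in at_top. \<forall>x\<in>X. norm (f (act A (Complex x y)) * g (act A (Complex x y)))
        \<le> (M * N) * exp ((C + D) * y)"
    proof eventually_elim
      case (elim y)
      show ?case
      proof
        fix x assume "x \<in> X"
        with elim have le: "norm (f (act A (Complex x y))) \<le> M * exp (C * y)"
          "norm (g (act A (Complex x y))) \<le> N * exp (D * y)" by auto
        have "norm (f (act A (Complex x y)) * g (act A (Complex x y)))
            \<le> (M * exp (C * y)) * (N * exp (D * y))"
          unfolding norm_mult by (intro mult_mono le order_trans[OF norm_ge_zero le(1)]) simp
        also have "\<dots> = (M * N) * exp ((C + D) * y)" by (simp add: exp_add ring_distribs)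
        finally show "norm (f (act A (Complex x y)) * g (act A (Complex x y)))
            \<le> (M * N) * exp ((C + D) * y)" .
      qed
    qed
    then show ?thesis by blast
  qed
  then show "\<exists>C. \<forall>X. bounded X \<longrightarrow> (\<exists>M. \<forall>\<^sub>F y in at_top. \<forall>x\<in>X.
      norm (f (act A (Complex x y)) * g (act A (Complex x y))) \<le> M * exp (C * y))" by blast
qed

lemma linear_exp_growth_const: "linear_exp_growth_at_cusps (\<lambda>_. c)"
  unfolding linear_exp_growth_at_cusps_def
  by (rule ballI, rule exI[of _ 0], intro allI impI exI[of _ "norm c"]) simp

lemma linear_exp_growth_norm:
  "linear_exp_growth_at_cusps f \<Longrightarrow> linear_exp_growth_at_cusps (\<lambda>\<tau>. of_real (norm (f \<tau>)))"
  by (erule linear_exp_growth_mono) simp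

lemma linear_exp_growth_sum:
  "(\<And>i. i \<in> I \<Longrightarrow> linear_exp_growth_at_cusps (f i)) \<Longrightarrow> linear_exp_growth_at_cusps (\<lambda>\<tau>. \<Sum>i\<in>I. f i \<tau>)"
  by (induction I rule: infinite_finite_induct)
    (auto intro: linear_exp_growth_add linear_exp_growth_const)

lemma linear_exp_growth_power:
  "linear_exp_growth_at_cusps f \<Longrightarrow> linear_exp_growth_at_cusps (\<lambda>\<tau>. f \<tau> ^ n)"
  by (induction n) (auto intro: linear_exp_growth_mult linear_exp_growth_const)

text \<open>With bottom row \<open>c\<close>, \<open>d\<close> of \<open>A\<close> the function is
  \<open>\<bar>c \<tau> + d\<bar>\<^sup>2 / Im \<tau> = c\<^sup>2 * y + (c * x + d)\<^sup>2 /
  y\<close>. For bounded \<open>x\<close> and \<open>y \<ge> 1\<close> this is at most linear in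
  \<open>y\<close>, so the exponential rate 1 serves every \<open>A\<close>.\<close>

lemma linear_exp_growth_inverse_Im: "linear_exp_growth_at_cusps (\<lambda>\<tau>. of_real (1 / Im \<tau>))"
  unfolding linear_exp_growth_at_cusps_def
proof (rule ballI, rule exI[of _ 1], intro allI impI)
  fix A and X :: "real set" assume "A \<in> SL2Z" "bounded X"
  then have A: "A \<in> SL2R" by (simp add: SL2Z_def)
  obtain R where R: "\<And>x. x \<in> X \<Longrightarrow> \<bar>x\<bar> \<le> R" using \<open>bounded X\<close> by (auto simp: bounded_iff)
  define K where "K = (\<bar>A$2$1\<bar> * R + \<bar>A$2$2\<bar>)\<^sup>2"
  have "\<forall>\<^sub>F y in at_top. \<forall>x\<in>X. norm (of_real (1 / Im (act A (Complex x y))) :: complex)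
      \<le> ((A$2$1)\<^sup>2 + K) * exp (1 * y)"
    using eventually_ge_at_top[of 1]
  proof eventually_elim
    case (elim y)
    show ?case
    proof
      fix x assume x: "x \<in> X"
      have uhp: "Complex x y \<in> uhp" using elim by (simp add: uhp_def)
      have "(cmod (jfac A (Complex x y)))\<^sup>2 = (A$2$1 * x + A$2$2)\<^sup>2 + (A$2$1)\<^sup>2 * y\<^sup>2"
        unfolding cmod_power2 by (simp add: jfac_def power_mult_distrib)
      then have "1 / Im (act A (Complex x y)) = (A$2$1)\<^sup>2 * y + (A$2$1 * x + A$2$2)\<^sup>2 / y"
        using elim unfolding Im_act[OF A uhp]
        by (simp add: add_divide_distrib power2_eq_square add.commute)
      also have "\<dots> \<le> (A$2$1)\<^sup>2 * exp y + K * exp y"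
      proof (rule add_mono)
        have y: "y \<le> exp y" "1 \<le> exp y"
          using exp_ge_add_one_self[of y] elim by linarith+
        then show "(A$2$1)\<^sup>2 * y \<le> (A$2$1)\<^sup>2 * exp y" by (intro mult_left_mono) auto
        have "\<bar>A$2$1 * x + A$2$2\<bar> \<le> \<bar>A$2$1\<bar> * R + \<bar>A$2$2\<bar>"
          by (rule order_trans[OF abs_triangle_ineq])
            (auto simp: abs_mult intro!: add_right_mono mult_left_mono R[OF x])
        from power_mono[OF this abs_ge_zero, of 2] have "(A$2$1 * x + A$2$2)\<^sup>2 \<le> K"
          by (simp add: K_def)
        moreover have "(A$2$1 * x + A$2$2)\<^sup>2 / y \<le> (A$2$1 * x + A$2$2)\<^sup>2 / 1"
          using elim by (intro divide_left_mono) auto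
        moreover have "K * 1 \<le> K * exp y"
          using y(2) by (intro mult_left_mono) (auto simp: K_def)
        ultimately show "(A$2$1 * x + A$2$2)\<^sup>2 / y \<le> K * exp y" by simp
      qed
      finally have "1 / Im (act A (Complex x y)) \<le> ((A$2$1)\<^sup>2 + K) * exp y"
        by (simp add: ring_distribs)
      moreover have "Im (act A (Complex x y)) > 0"
        using act_in_uhp[OF A uhp] by (simp add: uhp_def)
      ultimately show "norm (of_real (1 / Im (act A (Complex x y))) :: complex)
          \<le> ((A$2$1)\<^sup>2 + K) * exp (1 * y)" by (simp only: norm_of_real) simp
    qed
  qed
  then show "\<exists>M. \<forall>\<^sub>F y in at_top. \<forall>x\<in>X.
      norm (of_real (1 / Im (act A (Complex x y))) :: complex) \<le> M * exp (1 * y)" by blast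
qed

section \<open>The majorant of a definite decomposition\<close>

context definite_decomposition
begin

text \<open>In an orthogonal basis the representing vector can be written down by dividing by the
  nonzero squares. It provides the \<rho> that belongs to a given pair of dual vectors.\<close>

lemma representable:
  fixes F :: "'a set"
  assumes "finite F" "span F = UNIV" "linear \<phi>"
  shows "\<exists>x. \<forall>y. B x y = \<phi> y"
proof -
  obtain S where S: "finite S" "independent S" "span S = UNIV"
      and o: "\<forall>x\<in>S. \<forall>y\<in>S. x \<noteq> y \<longrightarrow> B x y = 0"
    using has_signature_dim[OF assms(1,2)] unfolding has_signature_def by blast
  let ?x = "\<Sum>s\<in>S. (\<phi> s / B s s) *\<^sub>R s"
  have "B ?x s = \<phi> s" if "s \<in> S" for s
    using orthogonal_sum_left[OF bilinear S(1) o that] orthogonal_basis_nonisotropic[OF S(2,3) o that]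
    by simp
  then have "B ?x y = \<phi> y" for y
    using linear_eq_on_span[of "B ?x" \<phi> S y] bilinear assms(3) S(3) by (simp add: bilinear_def)
  then show ?thesis by blast
qed

text \<open>The classical positive definite majorant of an indefinite form, obtained by reversing
  the sign on \<open>snd v\<close>.\<close>

definition majorant :: "'a \<Rightarrow> real" where
  "majorant x = B (pos x) (pos x) - B (neg x) (neg x)"

lemma form_pos_nonneg: "B (pos x) (pos x) \<ge> 0"
  using pos_definite[OF pos_in, of x] by (cases "pos x = 0") (simp_all add: form_simps)

lemma form_neg_nonpos: "B (neg x) (neg x) \<le> 0"
  using neg_definite[OF neg_in, of x] by (cases "neg x = 0") (simp_all add: form_simps)

lemma majorant_nonneg: "majorant x \<ge> 0"
  using form_pos_nonneg[of x] form_neg_nonpos[of x] by (simp add: majorant_def)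

lemma majorant_positive:
  assumes "x \<noteq> 0"
  shows "majorant x > 0"
proof (cases "pos x = 0")
  case True
  then have "neg x \<noteq> 0" using assms pos_add_neg[of x] by auto
  then show ?thesis
    using neg_definite[OF neg_in, of x] form_pos_nonneg[of x] by (simp add: majorant_def)
next
  case False
  then show ?thesis
    using pos_definite[OF pos_in, of x] form_neg_nonpos[of x] by (simp add: majorant_def)
qed

text \<open>The form pairs \<open>x\<close> with \<open>y\<close> as the majorant pairs \<open>x\<close> with \<open>pos y - neg y\<close>, so this is the
  Cauchy-Schwarz inequality for the majorant.\<close>

lemma form_square_le: "(B x y)\<^sup>2 \<le> majorant x * majorant y"
proof (cases "y = 0")
  case True
  then show ?thesis by (simp add: form_simps majorant_nonneg)
next
  case False
  then have y: "majorant y > 0" by (rule majorant_positive)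
  \<comment> \<open>The minimiser of the majorant along the line
    \<open>x + t (pos y - neg y)\<close>.\<close>
  define t where "t = - B x y / majorant y"
  define z where "z = (pos x + t *\<^sub>R pos y) + (neg x - t *\<^sub>R neg y)"
  have pz: "pos z = pos x + t *\<^sub>R pos y"
    unfolding z_def by (intro pos_eq subspace_add subspace_diff subspace_scale subspace_fst subspace_snd) auto
  have nz: "neg z = neg x - t *\<^sub>R neg y"
    unfolding z_def by (intro neg_eq subspace_add subspace_diff subspace_scale subspace_fst subspace_snd) auto
  have "majorant z = majorant x + 2 * t * (B (pos x) (pos y) + B (neg x) (neg y)) + t * t * majorant y"
    using sym[of "pos y" "pos x"] sym[of "neg y" "neg x"]
    unfolding majorant_def pz nz form_simps by (simp add: algebra_simps)
  also have "\<dots> = majorant x + 2 * t * B x y + t * (t * majorant y)"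
    using form_split[of x y] by simp
  also have "\<dots> = majorant x - (B x y)\<^sup>2 / majorant y"
    using y by (simp add: t_def power2_eq_square)
  finally show ?thesis using majorant_nonneg[of z] y by (simp add: pos_divide_le_eq)
qed

text \<open>Expansion around \<open>y\<close> with the cross term left as a value of the functional
  \<open>B (x - y)\<close>; in this form it can cancel against the cross term of a second
  form.\<close>

lemma form_pos_shift:
  "B (pos x) (pos x) = B (pos y) (pos y) + 2 * B (x - y) (pos y) + B (pos (x - y)) (pos (x - y))"
proof -
  have "pos x = pos y + pos (x - y)" by (simp flip: linear_add[OF linear_pos])
  then have "B (pos x) (pos x) = B (pos y + pos (x - y)) (pos y + pos (x - y))" by simp
  also have "\<dots> = B (pos y) (pos y) + 2 * B (pos (x - y)) (pos y) + B (pos (x - y)) (pos (x - y))"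
    using sym[of "pos y" "pos (x - y)"] by (simp only: form_simps(1,2))
  also have "B (pos (x - y)) (pos y) = B (x - y) (pos y)"
    using form_pos_pos[of y "x - y"] sym by metis
  finally show ?thesis .
qed

lemma form_neg_shift:
  "B (neg x) (neg x) = B (neg y) (neg y) + 2 * B (x - y) (neg y) + B (neg (x - y)) (neg (x - y))"
proof -
  have "neg x = neg y + neg (x - y)" by (simp flip: linear_add[OF linear_neg])
  then have "B (neg x) (neg x) = B (neg y + neg (x - y)) (neg y + neg (x - y))" by simp
  also have "\<dots> = B (neg y) (neg y) + 2 * B (neg (x - y)) (neg y) + B (neg (x - y)) (neg (x - y))"
    using sym[of "neg y" "neg (x - y)"] by (simp only: form_simps(1,2))
  also have "B (neg (x - y)) (neg y) = B (x - y) (neg y)"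
    using form_neg_neg[of y "x - y"] sym by metis
  finally show ?thesis .
qed

section \<open>The exponents of the Fourier series\<close>

lemma cext_pos_of_lat: "cext pos (of_lat x) = of_lat (pos x)"
  and cext_neg_of_lat: "cext neg (of_lat x) = of_lat (neg x)"
  by (rule cext_of_lat[OF linear_pos] cext_of_lat[OF linear_neg])+

lemma cform_of_lat: "cform B (of_lat x) (of_lat y) = of_real (B x y)"
  by (simp add: cform_def of_lat_def form_simps complex_eq_iff)

lemma cform_add_right: "cform B z (w + w') = cform B z w + cform B z w'"
  by (simp add: cform_def form_simps complex_eq_iff)

lemma cform_cscale_right: "cform B z (cscale c w) = c * cform B z w"
  by (simp add: cform_def cscale_def form_simps complex_eq_iff algebra_simps)

text \<open>The part of a Fourier exponent that is free of \<zeta>. Its imaginary part is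
  \<open>Im \<tau> * majorant x / 2\<close>, so \<open>ee (phase \<tau> x)\<close> has Gaussian
  decay in \<open>x\<close>.\<close>

definition phase :: "complex \<Rightarrow> 'a \<Rightarrow> complex" where
  "phase \<tau> x = \<tau> * of_real (B (pos x) (pos x)) / 2 + cnj \<tau> * of_real (B (neg x) (neg x)) / 2"

text \<open>The quadratic expansion behind two later steps: with a lattice vector as summand it is
  the quasi-periodicity of the series, with summand \<rho> it completes the square on a
  fibre.\<close>

lemma phase_add:
  "phase \<tau> (x + y) = phase \<tau> x + phase \<tau> y + \<tau> * of_real (B x (pos y)) + cnj \<tau> * of_real (B x (neg y))"
  using form_pos_shift[of "x + y" y] form_neg_shift[of "x + y" y]
  by (simp add: phase_def algebra_simps add_divide_distrib)

lemma fourier_expansion_iff: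
  "fourier_expansion L B v \<Phi> f \<longleftrightarrow> (\<forall>\<tau>\<in>uhp. \<forall>\<zeta>.
     ((\<lambda>x. f x \<tau> * ee (phase \<tau> x + cform B (of_lat x) \<zeta>)) has_sum \<Phi> \<tau> \<zeta>) (dual_lattice L B))"
  by (simp only: fourier_expansion_def phase_def cext_pos_of_lat cext_neg_of_lat cform_of_lat)

end

section \<open>Fourier coefficients\<close>

locale lattice_decomposition =
  fixes L :: "'a::real_normed_vector set" and B :: "'a \<Rightarrow> 'a \<Rightarrow> real" and v :: "'a set \<times> 'a set"
  assumes lattice: "even_lattice L B" and v_Gr: "v \<in> Gr B"

sublocale lattice_decomposition \<subseteq> definite_decomposition B v
  by (rule even_lattice_definite_decomposition[OF lattice v_Gr])

context lattice_decomposition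
begin

lemma dual_add: "x \<in> dual_lattice L B \<Longrightarrow> \<sigma> \<in> L \<Longrightarrow> x + \<sigma> \<in> dual_lattice L B"
  and dual_diff: "x \<in> dual_lattice L B \<Longrightarrow> \<sigma> \<in> L \<Longrightarrow> x - \<sigma> \<in> dual_lattice L B"
  using even_latticeD(4)[OF lattice] by (auto simp: dual_lattice_def form_simps)

text \<open>Rounding coordinates moves a dual vector into a bounded set without leaving its class
  modulo \<open>L\<close>. A dual vector is determined by its pairings with a spanning set in
  \<open>L\<close>; these are integers, so boundedness means finiteness.\<close>

lemma finite_dual_representatives:
  "\<exists>R. finite R \<and> R \<subseteq> dual_lattice L B \<and> (\<forall>x\<in>dual_lattice L B. \<exists>\<sigma>\<in>L. x - \<sigma> \<in> R)"
proof -
  obtain S where S: "finite S" "span S = UNIV" "S \<subseteq> L"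
    and L: "L = {\<Sum>x\<in>S. of_int (c x) *\<^sub>R x | c. True}"
    by (rule free_latticeE[OF even_latticeD(1)[OF lattice]]) blast
  \<comment> \<open>Fractional parts are below 1, so after rounding the pairing with
    \<open>t\<close> is at most the sum of \<open>\<bar>B s t\<bar>\<close> over \<open>s\<close>;
    the outer sum makes the bound independent of \<open>t\<close>.\<close>
  define M where "M = \<lceil>\<Sum>t\<in>S. \<Sum>s\<in>S. \<bar>B s t\<bar>\<rceil>"
  define R where "R = {x \<in> dual_lattice L B. \<forall>s\<in>S. \<bar>B x s\<bar> \<le> of_int M}"
  have "finite R"
  proof (rule inj_on_finite)
    let ?g = "\<lambda>x. restrict (\<lambda>s. \<lfloor>B x s\<rfloor>) S"
    show "inj_on ?g R"
    proof (rule inj_onI)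
      fix x y assume xy: "x \<in> R" "y \<in> R" "?g x = ?g y"
      show "x = y"
      proof (rule eq_on_spanning_set[OF S(2)])
        fix s assume s: "s \<in> S"
        then have "\<lfloor>B x s\<rfloor> = \<lfloor>B y s\<rfloor>" using xy(3) by (metis restrict_apply')
        moreover have "B x s \<in> \<int>" "B y s \<in> \<int>"
          using xy(1,2) s S(3) by (auto simp: R_def dual_lattice_def)
        ultimately show "B x s = B y s" by (metis Ints_cases floor_of_int)
      qed
    qed
    show "?g ` R \<subseteq> S \<rightarrow>\<^sub>E {- M..M}"
      by (auto simp: R_def abs_le_iff floor_le_iff le_floor_iff)
    show "finite (S \<rightarrow>\<^sub>E {- M..M})" using S(1) by (intro finite_PiE) auto
  qed
  moreover have "\<exists>\<sigma>\<in>L. x - \<sigma> \<in> R" if x: "x \<in> dual_lattice L B" for x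
  proof -
    have "x \<in> span S" by (simp add: S(2))
    then obtain c where c: "x = (\<Sum>s\<in>S. c s *\<^sub>R s)" unfolding span_finite[OF S(1)] by blast
    define \<sigma> where "\<sigma> = (\<Sum>s\<in>S. of_int \<lfloor>c s\<rfloor> *\<^sub>R s)"
    have \<sigma>: "\<sigma> \<in> L"
      unfolding L \<sigma>_def by (rule CollectI, rule exI[of _ "\<lambda>s. \<lfloor>c s\<rfloor>"]) simp
    have diff: "x - \<sigma> = (\<Sum>s\<in>S. frac (c s) *\<^sub>R s)"
      by (simp add: c \<sigma>_def frac_def scaleR_left_diff_distrib sum_subtractf)
    have "\<bar>B (x - \<sigma>) t\<bar> \<le> of_int M" if t: "t \<in> S" for t
    proof -
      have "\<bar>B (x - \<sigma>) t\<bar> \<le> (\<Sum>s\<in>S. \<bar>frac (c s) * B s t\<bar>)"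
        unfolding diff bilinear_sum_left[OF bilinear] real_scaleR_def by (rule sum_abs)
      also have "\<dots> \<le> (\<Sum>s\<in>S. \<bar>B s t\<bar>)"
        by (intro sum_mono) (simp add: abs_mult frac_lt_1 less_imp_le mult_left_le_one_le)
      also have "\<dots> \<le> (\<Sum>t\<in>S. \<Sum>s\<in>S. \<bar>B s t\<bar>)"
        by (rule member_le_sum[OF t _ S(1)]) (simp add: sum_nonneg)
      also have "\<dots> \<le> of_int M" unfolding M_def by (rule le_of_int_ceiling)
      finally show ?thesis .
    qed
    then show ?thesis using dual_diff[OF x \<sigma>] \<sigma> by (auto simp: R_def)
  qed
  ultimately show ?thesis by (intro exI[of _ R]) (auto simp: R_def)
qed

text \<open>Pairing with \<open>S\<close> embeds the dual lattice into integer tuples, and by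
  \<open>form_square_le\<close> the squares of the pairings sum to at most \<open>W\<close> times
  the majorant. The sum is thus dominated by a product of \<open>card S\<close> one-dimensional
  Gaussian sums with parameter \<open>b / W\<close>, each bounded independently of the
  centre.\<close>

lemma gaussian_sum_bound:
  "\<exists>W n. W > 0 \<and> (\<forall>\<rho> b F. b > 0 \<longrightarrow> finite F \<longrightarrow> F \<subseteq> dual_lattice L B \<longrightarrow>
     (\<Sum>x\<in>F. exp (- b * majorant (x - \<rho>))) \<le> (15 * (1 + W / b)) ^ n)"
proof -
  obtain S where S: "finite S" "span S = UNIV" "S \<subseteq> L"
    by (rule free_latticeE[OF even_latticeD(1)[OF lattice]]) blast
  \<comment> \<open>The summand 1 keeps \<open>W\<close> positive in rank 0 as well.\<close>
  define W where "W = 1 + (\<Sum>s\<in>S. majorant s)"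
  have W: "W > 0" by (simp add: W_def add_pos_nonneg majorant_nonneg sum_nonneg)
  have maj: "(\<Sum>s\<in>S. (B x s)\<^sup>2) \<le> majorant x * W" for x
  proof -
    have "(\<Sum>s\<in>S. (B x s)\<^sup>2) \<le> (\<Sum>s\<in>S. majorant x * majorant s)"
      by (intro sum_mono form_square_le)
    also have "\<dots> \<le> majorant x * W"
      by (simp add: W_def distrib_left majorant_nonneg flip: sum_distrib_left)
    finally show ?thesis .
  qed
  have "(\<Sum>x\<in>F. exp (- b * majorant (x - \<rho>))) \<le> (15 * (1 + W / b)) ^ card S"
    if b: "b > 0" and F: "finite F" "F \<subseteq> dual_lattice L B" for \<rho> b F
  proof -
    define e where "e s k = exp (- (b / W) * (of_int k - B \<rho> s)\<^sup>2)" for s and k :: int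
    define g where "g x = restrict (\<lambda>s. \<lfloor>B x s\<rfloor>) S" for x
    define T where "T = (\<lambda>(x, s). \<lfloor>B x s\<rfloor>) ` (F \<times> S)"
    have int: "of_int \<lfloor>B x s\<rfloor> = B x s" if "x \<in> F" "s \<in> S" for x s
    proof -
      have "B x s \<in> \<int>" using that F(2) S(3) by (auto simp: dual_lattice_def)
      then show ?thesis by (metis Ints_cases floor_of_int)
    qed
    have inj: "inj_on g F"
    proof (rule inj_onI)
      fix x y assume xy: "x \<in> F" "y \<in> F" "g x = g y"
      show "x = y"
      proof (rule eq_on_spanning_set[OF S(2)])
        fix s assume s: "s \<in> S"
        then have "\<lfloor>B x s\<rfloor> = \<lfloor>B y s\<rfloor>" using xy(3) unfolding g_def by (metis restrict_apply')
        then show "B x s = B y s" using int xy(1,2) s by metis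
      qed
    qed
    have le: "exp (- b * majorant (x - \<rho>)) \<le> (\<Prod>s\<in>S. e s (g x s))" if x: "x \<in> F" for x
    proof -
      have "(b / W) * (\<Sum>s\<in>S. (B (x - \<rho>) s)\<^sup>2) \<le> (b / W) * (majorant (x - \<rho>) * W)"
        using b W by (intro mult_left_mono maj) simp
      also have "\<dots> = b * majorant (x - \<rho>)" using W by simp
      finally have "exp (- b * majorant (x - \<rho>)) \<le> exp (\<Sum>s\<in>S. - (b / W) * (B (x - \<rho>) s)\<^sup>2)"
        unfolding sum_distrib_left[symmetric] by simp
      also have "\<dots> = (\<Prod>s\<in>S. exp (- (b / W) * (B (x - \<rho>) s)\<^sup>2))" by (rule exp_sum[OF S(1)])
      also have "\<dots> = (\<Prod>s\<in>S. e s (g x s))"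
        by (intro prod.cong) (simp_all add: e_def g_def int x form_simps)
      finally show ?thesis .
    qed
    have T: "finite T" using F(1) S(1) by (simp add: T_def)
    have "(\<Sum>x\<in>F. exp (- b * majorant (x - \<rho>))) \<le> (\<Sum>x\<in>F. \<Prod>s\<in>S. e s (g x s))"
      by (intro sum_mono le)
    also have "\<dots> = (\<Sum>k\<in>g ` F. \<Prod>s\<in>S. e s (k s))" by (simp add: sum.reindex[OF inj])
    also have "\<dots> \<le> (\<Sum>k\<in>S \<rightarrow>\<^sub>E T. \<Prod>s\<in>S. e s (k s))"
    proof (rule sum_mono2)
      show "finite (S \<rightarrow>\<^sub>E T)" using S(1) T by (intro finite_PiE) auto
      show "g ` F \<subseteq> S \<rightarrow>\<^sub>E T" by (auto simp: g_def T_def)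
      show "0 \<le> (\<Prod>s\<in>S. e s (k s))" for k by (intro prod_nonneg) (simp add: e_def)
    qed
    also have "\<dots> = (\<Prod>s\<in>S. \<Sum>k\<in>T. e s k)"
      by (rule prod_sum_PiE[OF S(1) T, symmetric])
    also have "\<dots> \<le> (\<Prod>s\<in>S. 15 * (1 + 1 / (b / W)))"
    proof (intro prod_mono conjI)
      show "0 \<le> (\<Sum>k\<in>T. e s k)" for s by (intro sum_nonneg) (simp add: e_def)
      show "(\<Sum>k\<in>T. e s k) \<le> 15 * (1 + 1 / (b / W))" for s
        unfolding e_def using b W by (intro sum_gaussian_int_le T) simp
    qed
    finally show ?thesis by simp
  qed
  with W show ?thesis by blast
qed

text \<open>Translating the elliptic variable by
  \<open>\<tau> \<sigma>\<^sub>+ + cnj \<tau> \<sigma>\<^sub>-\<close> turns the term of index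
  \<open>x\<close> into that of index \<open>x + \<sigma>\<close>, up to the automorphy factor. The
  transformation law thus yields two expansions of the same function, and uniqueness compares
  them.\<close>

lemma fourier_coefficient_periodic:
  assumes "jacobi_form \<Gamma> k l L B v \<Phi>" "fourier_expansion L B v \<Phi> f"
    and "\<tau> \<in> uhp" "x \<in> dual_lattice L B" "\<sigma> \<in> L"
  shows "f (x + \<sigma>) \<tau> = f x \<tau>"
proof -
  let ?D = "dual_lattice L B"
  have F: "((\<lambda>x. f x \<tau> * ee (phase \<tau> x + cform B (of_lat x) \<zeta>)) has_sum \<Phi> \<tau> \<zeta>) ?D" for \<zeta>
    using assms(2,3) unfolding fourier_expansion_iff by blast
  have zero: "0 \<in> L" by (rule free_latticeE[OF even_latticeD(1)[OF lattice]])
  have bij: "bij_betw (\<lambda>x. x - \<sigma>) ?D ?D"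
    by (rule bij_betwI[of _ _ _ "\<lambda>x. x + \<sigma>"]) (use dual_add dual_diff assms(5) in auto)
  \<comment> \<open>The difference of the two expansions; the claim is its vanishing at
    \<open>x + \<sigma>\<close>.\<close>
  define a where "a x = (f x \<tau> - f (x - \<sigma>) \<tau>) * ee (phase \<tau> x)" for x
  have sum0: "((\<lambda>x. a x * ee (of_real (B x \<xi>))) has_sum 0) ?D" for \<xi>
  proof -
    \<comment> \<open>A translate of the real point \<xi>. The last summand is \<nu> = 0, which
      matches the form of the transformation law.\<close>
    define \<zeta> where "\<zeta> = of_lat \<xi> + cscale \<tau> (of_lat (pos \<sigma>)) + cscale (cnj \<tau>) (of_lat (neg \<sigma>)) + of_lat 0"
    have \<zeta>: "cform B (of_lat x) \<zeta>
        = of_real (B x \<xi>) + \<tau> * of_real (B x (pos \<sigma>)) + cnj \<tau> * of_real (B x (neg \<sigma>))" for x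
      by (simp add: \<zeta>_def cform_add_right cform_cscale_right cform_of_lat form_simps)
    have "\<Phi> \<tau> \<zeta> = ee (- phase \<tau> \<sigma> - of_real (B \<sigma> \<xi>)) * \<Phi> \<tau> (of_lat \<xi>)"
      using assms(1)[unfolded jacobi_form_def, THEN conjunct2, THEN conjunct1, rule_format,
          OF assms(3,5) zero, of "of_lat \<xi>"]
      unfolding cext_pos_of_lat cext_neg_of_lat cform_of_lat \<zeta>_def[symmetric]
      by (simp add: phase_def)
    \<comment> \<open>Multiplying by the inverse automorphy factor leaves exactly what
      \<open>phase_add\<close> needs in order to merge \<sigma> into the index.\<close>
    then have "ee (phase \<tau> \<sigma> + of_real (B \<sigma> \<xi>)) * \<Phi> \<tau> \<zeta> = \<Phi> \<tau> (of_lat \<xi>)"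
      by (simp add: ee_add[symmetric] mult.assoc[symmetric])
    with has_sum_cmult_right[OF F[of \<zeta>], of "ee (phase \<tau> \<sigma> + of_real (B \<sigma> \<xi>))"]
    have "((\<lambda>x. ee (phase \<tau> \<sigma> + of_real (B \<sigma> \<xi>)) * (f x \<tau> * ee (phase \<tau> x + cform B (of_lat x) \<zeta>)))
        has_sum \<Phi> \<tau> (of_lat \<xi>)) ?D" by simp
    moreover have "ee (phase \<tau> \<sigma> + of_real (B \<sigma> \<xi>)) * (f x \<tau> * ee (phase \<tau> x + cform B (of_lat x) \<zeta>))
        = f x \<tau> * ee (phase \<tau> (x + \<sigma>) + of_real (B (x + \<sigma>) \<xi>))" for x
    proof -
      have "phase \<tau> (x + \<sigma>) + of_real (B (x + \<sigma>) \<xi>)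
          = (phase \<tau> \<sigma> + of_real (B \<sigma> \<xi>)) + (phase \<tau> x + cform B (of_lat x) \<zeta>)"
        by (simp add: phase_add \<zeta> form_simps)
      then show ?thesis by (simp only: ee_add) (simp only: mult_ac)
    qed
    ultimately have "((\<lambda>x. f x \<tau> * ee (phase \<tau> (x + \<sigma>) + of_real (B (x + \<sigma>) \<xi>)))
        has_sum \<Phi> \<tau> (of_lat \<xi>)) ?D" by simp
    then have "((\<lambda>x. f (x - \<sigma>) \<tau> * ee (phase \<tau> (x - \<sigma> + \<sigma>) + of_real (B (x - \<sigma> + \<sigma>) \<xi>)))
        has_sum \<Phi> \<tau> (of_lat \<xi>)) ?D"
      by (rule has_sum_reindex_bij_betw[OF bij, THEN iffD2,
            of "\<lambda>x. f x \<tau> * ee (phase \<tau> (x + \<sigma>) + of_real (B (x + \<sigma>) \<xi>))"])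
    then have "((\<lambda>x. f (x - \<sigma>) \<tau> * ee (phase \<tau> x + of_real (B x \<xi>))) has_sum \<Phi> \<tau> (of_lat \<xi>)) ?D"
      by (simp only: diff_add_cancel)
    from has_sum_add[OF F[of "of_lat \<xi>", unfolded cform_of_lat] has_sum_cmult_right[OF this, of "-1"]]
    have "((\<lambda>x. f x \<tau> * ee (phase \<tau> x + of_real (B x \<xi>))
        + (- 1) * (f (x - \<sigma>) \<tau> * ee (phase \<tau> x + of_real (B x \<xi>)))) has_sum 0) ?D"
      by simp
    moreover have "f x \<tau> * ee (phase \<tau> x + of_real (B x \<xi>))
        + (- 1) * (f (x - \<sigma>) \<tau> * ee (phase \<tau> x + of_real (B x \<xi>))) = a x * ee (of_real (B x \<xi>))" for x
      unfolding a_def ee_add by (simp add: left_diff_distrib)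
    ultimately show ?thesis by (simp only:)
  qed
  have "a (x + \<sigma>) = 0"
  proof (rule exponential_sum_eq_0[OF bilinear _ sum0])
    show "\<exists>y. B x y \<noteq> 0" if "x \<noteq> 0" for x using nondegenerate that by blast
    show "x + \<sigma> \<in> ?D" using dual_add assms(4,5) by blast
  qed
  then show ?thesis by (simp add: a_def)
qed

text \<open>One bound for all indices at once: every coefficient equals one with index in a finite
  set. A sum of norms is used since growth at the cusps is stable under finite sums.\<close>

lemma fourier_coefficient_bound:
  assumes "jacobi_form \<Gamma> k l L B v \<Phi>" "fourier_expansion L B v \<Phi> f"
  shows "\<exists>R. finite R \<and> R \<subseteq> dual_lattice L B \<and>
    (\<forall>\<tau>\<in>uhp. \<forall>x\<in>dual_lattice L B. norm (f x \<tau>) \<le> (\<Sum>r\<in>R. norm (f r \<tau>)))"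
proof -
  obtain R where R: "finite R" "R \<subseteq> dual_lattice L B"
    "\<forall>x\<in>dual_lattice L B. \<exists>\<sigma>\<in>L. x - \<sigma> \<in> R"
    using finite_dual_representatives by (elim exE conjE)
  have "norm (f x \<tau>) \<le> (\<Sum>r\<in>R. norm (f r \<tau>))" if \<tau>: "\<tau> \<in> uhp" and x: "x \<in> dual_lattice L B" for \<tau> x
  proof -
    obtain \<sigma> where \<sigma>: "\<sigma> \<in> L" "x - \<sigma> \<in> R" using R(3) x by blast
    have "f x \<tau> = f (x - \<sigma>) \<tau>"
      using fourier_coefficient_periodic[OF assms \<tau> dual_diff[OF x \<sigma>(1)] \<sigma>(1)] by simp
    then show ?thesis using member_le_sum[OF \<sigma>(2), of "\<lambda>r. norm (f r \<tau>)"] R(1) by simp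
  qed
  with R show ?thesis by blast
qed

end

section \<open>Products of Jacobi forms on one lattice\<close>

locale lattice_decomposition_pair =
  B: lattice_decomposition L B v + B': lattice_decomposition L B' v
  for L :: "'a::real_normed_vector set" and B B' :: "'a \<Rightarrow> 'a \<Rightarrow> real" and v :: "'a set \<times> 'a set"
begin

abbreviation M :: "'a \<Rightarrow> 'a \<Rightarrow> real" where
  "M x y \<equiv> B x y + B' x y"

sublocale M: lattice_decomposition L M v
proof
  show "even_lattice L M" by (rule even_lattice_add[OF B.lattice B'.lattice B.v_Gr B'.v_Gr])
  show "v \<in> Gr M"
    by (rule definite_decomposition.Gr[OF definite_decomposition_add])
      (rule B.definite_decomposition_axioms B'.definite_decomposition_axioms)+
qed

lemma proj_eq: "B'.pos = B.pos" "B'.neg = B.neg" "M.pos = B.pos" "M.neg = B.neg"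
proof -
  have "B'.pos x = B.pos x \<and> B'.neg x = B.neg x \<and> M.pos x = B.pos x \<and> M.neg x = B.neg x" for x
    using B'.pos_eq[of "B.pos x" "B.neg x"] B'.neg_eq[of "B.pos x" "B.neg x"]
      M.pos_eq[of "B.pos x" "B.neg x"] M.neg_eq[of "B.pos x" "B.neg x"]
    unfolding B.pos_add_neg by simp
  then show "B'.pos = B.pos" "B'.neg = B.neg" "M.pos = B.pos" "M.neg = B.neg"
    by blast+
qed

text \<open>The pairs of characters of \<open>L\<close> whose product is the character given by \<open>\<rho>\<close>.\<close>

definition fibre :: "'a \<Rightarrow> ('a \<times> 'a) set" where
  "fibre \<rho> = {(x, y) \<in> dual_lattice L B \<times> dual_lattice L B'. \<forall>z. B x z + B' y z = M \<rho> z}"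

lemma fibreD:
  assumes "(x, y) \<in> fibre \<rho>"
  shows "x \<in> dual_lattice L B" "y \<in> dual_lattice L B'" "B x z + B' y z = M \<rho> z"
  using assms by (auto simp: fibre_def)

text \<open>Each pair of dual vectors lies over exactly one \<rho>: existence by representability of
  the summed functional, uniqueness by nondegeneracy of \<open>M\<close>. This allows the product
  series to be grouped by \<rho>.\<close>

lemma bij_betw_fibres:
  "bij_betw snd (Sigma (dual_lattice L M) fibre) (dual_lattice L B \<times> dual_lattice L B')"
proof (rule bij_betw_imageI)
  show "inj_on snd (Sigma (dual_lattice L M) fibre)"
  proof (rule inj_onI)
    fix p q assume pq: "p \<in> Sigma (dual_lattice L M) fibre" "q \<in> Sigma (dual_lattice L M) fibre"
      "snd p = snd q"
    obtain \<rho> x y where p: "p = (\<rho>, (x, y))" by (metis surj_pair)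
    obtain \<rho>' where q: "q = (\<rho>', (x, y))" using pq(3) p by (metis prod.collapse snd_conv)
    have "M (\<rho> - \<rho>') z = 0" for z
      using fibreD(3)[of x y \<rho> z] fibreD(3)[of x y \<rho>' z] pq(1,2) p q
      by (simp add: B.form_simps B'.form_simps)
    then have "\<rho> - \<rho>' = 0" by (rule M.nondegenerate)
    then show "p = q" by (simp add: p q)
  qed
  show "snd ` Sigma (dual_lattice L M) fibre = dual_lattice L B \<times> dual_lattice L B'"
  proof
    show "snd ` Sigma (dual_lattice L M) fibre \<subseteq> dual_lattice L B \<times> dual_lattice L B'"
      by (auto simp: fibre_def)
    show "dual_lattice L B \<times> dual_lattice L B' \<subseteq> snd ` Sigma (dual_lattice L M) fibre"
    proof
      fix p assume p: "p \<in> dual_lattice L B \<times> dual_lattice L B'"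
      obtain x y where xy: "p = (x, y)" by (metis surj_pair)
      obtain S :: "'a set" where S: "finite S" "span S = UNIV"
        by (rule free_latticeE[OF even_latticeD(1)[OF B.lattice]]) (rule that, assumption, assumption)
      have "linear (B x)" "linear (B' y)"
        using B.bilinear B'.bilinear by (simp_all add: bilinear_def)
      from M.representable[OF S linear_compose_add[OF this]]
      obtain \<rho> where \<rho>: "\<forall>z. M \<rho> z = B x z + B' y z" by (elim exE)
      have "M \<rho> z \<in> \<int>" if "z \<in> L" for z
        using p that by (simp add: \<rho>[rule_format] xy dual_lattice_def)
      then have "\<rho> \<in> dual_lattice L M" by (simp add: dual_lattice_def)
      moreover have "p \<in> fibre \<rho>" using p \<rho> by (simp add: fibre_def xy)
      ultimately have "(\<rho>, p) \<in> Sigma (dual_lattice L M) fibre" by (rule SigmaI)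
      then show "p \<in> snd ` Sigma (dual_lattice L M) fibre" by (rule image_eqI[rotated]) simp
    qed
  qed
qed

text \<open>The part of \<open>phase \<tau> x + phase \<tau> y\<close> that is not accounted for by \<open>phase \<tau> \<rho>\<close>. On the fibre
  over \<open>\<rho>\<close> the cross terms vanish, so that it is a definite quadratic function of \<open>x - \<rho>\<close> and \<open>y - \<rho>\<close>.\<close>

definition excess :: "complex \<Rightarrow> 'a \<Rightarrow> 'a \<Rightarrow> 'a \<Rightarrow> complex" where
  "excess \<tau> \<rho> x y = B.phase \<tau> (x - \<rho>) + B'.phase \<tau> (y - \<rho>)"

lemma phase_fibre:
  assumes "(x, y) \<in> fibre \<rho>"
  shows "B.phase \<tau> x + B'.phase \<tau> y = excess \<tau> \<rho> x y + M.phase \<tau> \<rho>"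
proof -
  \<comment> \<open>The differences represent opposite functionals, so the terms linear in them,
    evaluated at the two projections of \<rho>, cancel between \<open>B\<close> and
    \<open>B'\<close>.\<close>
  have "B (x - \<rho>) z + B' (y - \<rho>) z = 0" for z
    using fibreD(3)[OF assms, of z] by (simp add: B.form_simps B'.form_simps)
  then have "of_real (B (x - \<rho>) z) + of_real (B' (y - \<rho>) z) = (0::complex)" for z
    by (metis of_real_add of_real_0)
  then have 0: "of_real (B' (y - \<rho>) z) = - (of_real (B (x - \<rho>) z) :: complex)" for z
    by (simp add: add_eq_0_iff)
  have "B.phase \<tau> x = B.phase \<tau> (x - \<rho>) + B.phase \<tau> \<rho>
      + \<tau> * of_real (B (x - \<rho>) (B.pos \<rho>)) + cnj \<tau> * of_real (B (x - \<rho>) (B.neg \<rho>))"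
    using B.phase_add[of \<tau> "x - \<rho>" \<rho>] by simp
  moreover have "B'.phase \<tau> y = B'.phase \<tau> (y - \<rho>) + B'.phase \<tau> \<rho>
      + \<tau> * of_real (B' (y - \<rho>) (B.pos \<rho>)) + cnj \<tau> * of_real (B' (y - \<rho>) (B.neg \<rho>))"
    using B'.phase_add[of \<tau> "y - \<rho>" \<rho>] by (simp add: proj_eq)
  moreover have "M.phase \<tau> \<rho> = B.phase \<tau> \<rho> + B'.phase \<tau> \<rho>"
    unfolding M.phase_def B.phase_def B'.phase_def proj_eq
    by (simp add: ring_distribs add_divide_distrib)
  ultimately show ?thesis unfolding excess_def 0 by simp
qed

text \<open>The contribution of \<open>y\<close> only improves the decay and is discarded. Nothing
  is lost in the subsequent sum, since on a fibre \<open>x\<close> determines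
  \<open>y\<close>.\<close>

lemma norm_ee_excess:
  assumes "\<tau> \<in> uhp"
  shows "norm (ee (excess \<tau> \<rho> x y)) \<le> exp (- (pi * Im \<tau>) * B.majorant (x - \<rho>))"
proof -
  have "Im (excess \<tau> \<rho> x y) = Im \<tau> * (B.majorant (x - \<rho>) + B'.majorant (y - \<rho>)) / 2"
    unfolding excess_def B.phase_def B'.phase_def B.majorant_def B'.majorant_def
    by (simp add: algebra_simps add_divide_distrib diff_divide_distrib)
  moreover have "Im \<tau> * B.majorant (x - \<rho>) \<le> Im \<tau> * (B.majorant (x - \<rho>) + B'.majorant (y - \<rho>))"
    using assms B'.majorant_nonneg[of "y - \<rho>"] by (intro mult_left_mono) (simp_all add: uhp_def)
  ultimately have "- 2 * pi * Im (excess \<tau> \<rho> x y) \<le> - (pi * Im \<tau>) * B.majorant (x - \<rho>)"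
    using pi_gt_zero by (simp add: mult.assoc mult_left_mono)
  then show ?thesis unfolding norm_ee by simp
qed

text \<open>Projection of a fibre to its first component is injective, by nondegeneracy of
  \<open>B'\<close>. What remains is a Gaussian sum with \<open>b = pi * Im \<tau>\<close>, whence
  the constant \<open>W / pi\<close>.\<close>

lemma finite_sum_excess_bound:
  "\<exists>W n. W > 0 \<and> (\<forall>\<tau>\<in>uhp. \<forall>\<rho> X. finite X \<longrightarrow> X \<subseteq> fibre \<rho> \<longrightarrow>
     (\<Sum>(x, y)\<in>X. norm (ee (excess \<tau> \<rho> x y))) \<le> (15 * (1 + W / Im \<tau>)) ^ n)"
proof -
  obtain W n where "W > 0" and W: "\<forall>\<rho> b F. b > 0 \<longrightarrow> finite F \<longrightarrow> F \<subseteq> dual_lattice L B \<longrightarrow>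
     (\<Sum>x\<in>F. exp (- b * B.majorant (x - \<rho>))) \<le> (15 * (1 + W / b)) ^ n"
    using B.gaussian_sum_bound by (elim exE conjE)
  have "(\<Sum>(x, y)\<in>X. norm (ee (excess \<tau> \<rho> x y))) \<le> (15 * (1 + (W / pi) / Im \<tau>)) ^ n"
    if \<tau>: "\<tau> \<in> uhp" and X: "finite X" "X \<subseteq> fibre \<rho>" for \<tau> \<rho> X
  proof -
    have inj: "inj_on fst X"
    proof (rule inj_onI)
      fix p q assume "p \<in> X" "q \<in> X" "fst p = fst q"
      then obtain x y y' where pq: "p = (x, y)" "q = (x, y')" "(x, y) \<in> fibre \<rho>" "(x, y') \<in> fibre \<rho>"
        using X(2) by (cases p, cases q) auto
      have "B' (y - y') z = 0" for z
        using fibreD(3)[OF pq(3), of z] fibreD(3)[OF pq(4), of z] by (simp add: B'.form_simps)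
      then have "y - y' = 0" by (rule B'.nondegenerate)
      then show "p = q" by (simp add: pq)
    qed
    have "(\<Sum>(x, y)\<in>X. norm (ee (excess \<tau> \<rho> x y)))
        \<le> (\<Sum>p\<in>X. exp (- (pi * Im \<tau>) * B.majorant (fst p - \<rho>)))"
      unfolding case_prod_beta by (intro sum_mono norm_ee_excess \<tau>)
    also have "\<dots> = (\<Sum>x\<in>fst ` X. exp (- (pi * Im \<tau>) * B.majorant (x - \<rho>)))"
      by (simp add: sum.reindex[OF inj])
    also have "\<dots> \<le> (15 * (1 + W / (pi * Im \<tau>))) ^ n"
    proof (rule W[rule_format])
      show "pi * Im \<tau> > 0" using \<tau> by (simp add: uhp_def)
      show "finite (fst ` X)" using X(1) by simp
      show "fst ` X \<subseteq> dual_lattice L B" using X(2) fibreD(1) by auto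
    qed
    finally show ?thesis by simp
  qed
  moreover have "W / pi > 0" using \<open>W > 0\<close> by simp
  ultimately show ?thesis by blast
qed

text \<open>All pairs over the same \<rho> carry the same dependence on \<zeta>, so the common
  exponential comes out of the sum over the fibre. Absolute convergence of the product series
  permits this grouping.\<close>

lemma fourier_expansion_mult:
  assumes \<Phi>: "jacobi_form \<Gamma> k l L B v \<Phi>" and \<Psi>: "jacobi_form \<Gamma> \<kappa> \<mu> L B' v \<Psi>"
  shows "\<exists>h. fourier_expansion L M v (\<lambda>\<tau> \<zeta>. \<Phi> \<tau> \<zeta> * \<Psi> \<tau> \<zeta>) h \<and>
    (\<forall>x\<in>dual_lattice L M. linear_exp_growth_at_cusps (h x))"
proof -
  let ?D = "dual_lattice L B" and ?D' = "dual_lattice L B'"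
  obtain f where f: "fourier_expansion L B v \<Phi> f"
      and fg: "\<And>x. x \<in> ?D \<Longrightarrow> linear_exp_growth_at_cusps (f x)"
    using \<Phi> unfolding jacobi_form_def by auto
  obtain g where g: "fourier_expansion L B' v \<Psi> g"
      and gg: "\<And>x. x \<in> ?D' \<Longrightarrow> linear_exp_growth_at_cusps (g x)"
    using \<Psi> unfolding jacobi_form_def by auto
  define t where "t \<tau> \<rho> p = f (fst p) \<tau> * g (snd p) \<tau> * ee (excess \<tau> \<rho> (fst p) (snd p))" for \<tau> \<rho> p
  define h where "h \<rho> \<tau> = infsum (t \<tau> \<rho>) (fibre \<rho>)" for \<rho> \<tau>
  have "fourier_expansion L M v (\<lambda>\<tau> \<zeta>. \<Phi> \<tau> \<zeta> * \<Psi> \<tau> \<zeta>) h"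
    unfolding M.fourier_expansion_iff
  proof (intro ballI allI)
    fix \<tau> \<zeta> assume \<tau>: "\<tau> \<in> uhp"
    let ?F = "\<lambda>x. f x \<tau> * ee (B.phase \<tau> x + cform B (of_lat x) \<zeta>)"
    let ?G = "\<lambda>y. g y \<tau> * ee (B'.phase \<tau> y + cform B' (of_lat y) \<zeta>)"
    have "(?F has_sum \<Phi> \<tau> \<zeta>) ?D" "(?G has_sum \<Psi> \<tau> \<zeta>) ?D'"
      using f[unfolded B.fourier_expansion_iff, rule_format, OF \<tau>]
        g[unfolded B'.fourier_expansion_iff, rule_format, OF \<tau>] by this
    from has_sum_mult_Times[OF this]
    have prod: "((\<lambda>(x, y). ?F x * ?G y) has_sum \<Phi> \<tau> \<zeta> * \<Psi> \<tau> \<zeta>) (?D \<times> ?D')" .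
    then have sigma: "((\<lambda>z. (\<lambda>(x, y). ?F x * ?G y) (snd z)) has_sum \<Phi> \<tau> \<zeta> * \<Psi> \<tau> \<zeta>)
        (Sigma (dual_lattice L M) fibre)"
      by (rule has_sum_reindex_bij_betw[OF bij_betw_fibres, THEN iffD2])
    show "((\<lambda>\<rho>. h \<rho> \<tau> * ee (M.phase \<tau> \<rho> + cform M (of_lat \<rho>) \<zeta>))
        has_sum \<Phi> \<tau> \<zeta> * \<Psi> \<tau> \<zeta>) (dual_lattice L M)"
    proof (rule has_sum_SigmaD[OF sigma])
      fix \<rho> assume "\<rho> \<in> dual_lattice L M"
      have term_eq: "?F (fst p) * ?G (snd p) = t \<tau> \<rho> p * ee (M.phase \<tau> \<rho> + cform M (of_lat \<rho>) \<zeta>)"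
        if "p \<in> fibre \<rho>" for p
      proof -
        have p: "(fst p, snd p) \<in> fibre \<rho>" using that by simp
        have "cform B (of_lat (fst p)) \<zeta> + cform B' (of_lat (snd p)) \<zeta> = cform M (of_lat \<rho>) \<zeta>"
          using fibreD(3)[OF p]
          by (simp add: cform_def of_lat_def B.form_simps B'.form_simps complex_eq_iff)
        note eqs = phase_fibre[OF p, of \<tau>] this
        let ?X = "B.phase \<tau> (fst p) + cform B (of_lat (fst p)) \<zeta>"
        let ?Y = "B'.phase \<tau> (snd p) + cform B' (of_lat (snd p)) \<zeta>"
        let ?Z = "M.phase \<tau> \<rho> + cform M (of_lat \<rho>) \<zeta>"
        have "?X + ?Y = (B.phase \<tau> (fst p) + B'.phase \<tau> (snd p))
            + (cform B (of_lat (fst p)) \<zeta> + cform B' (of_lat (snd p)) \<zeta>)"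
          by (simp only: add_ac)
        also have "\<dots> = excess \<tau> \<rho> (fst p) (snd p) + ?Z" unfolding eqs by (rule add.assoc)
        finally have XY: "?X + ?Y = excess \<tau> \<rho> (fst p) (snd p) + ?Z" .
        have "?F (fst p) * ?G (snd p) = f (fst p) \<tau> * g (snd p) \<tau> * ee (?X + ?Y)"
          unfolding ee_add[of ?X ?Y] by (simp only: mult_ac)
        also have "\<dots> = t \<tau> \<rho> p * ee ?Z"
          unfolding XY ee_add[of _ ?Z] t_def by (simp only: mult_ac)
        finally show ?thesis .
      qed
      have "(\<lambda>p. ?F (fst p) * ?G (snd p)) summable_on ?D \<times> ?D'"
        using has_sum_imp_summable[OF prod] unfolding case_prod_beta' .
      then have "(\<lambda>p. ?F (fst p) * ?G (snd p)) summable_on fibre \<rho>"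
        by (rule summable_on_subset_banach) (auto simp: fibre_def)
      then have "((\<lambda>p. ?F (fst p) * ?G (snd p)) has_sum
          infsum (\<lambda>p. ?F (fst p) * ?G (snd p)) (fibre \<rho>)) (fibre \<rho>)"
        by (rule has_sum_infsum)
      also have "infsum (\<lambda>p. ?F (fst p) * ?G (snd p)) (fibre \<rho>)
          = infsum (\<lambda>p. t \<tau> \<rho> p * ee (M.phase \<tau> \<rho> + cform M (of_lat \<rho>) \<zeta>)) (fibre \<rho>)"
        by (rule infsum_cong) (rule term_eq)
      also have "\<dots> = h \<rho> \<tau> * ee (M.phase \<tau> \<rho> + cform M (of_lat \<rho>) \<zeta>)"
        unfolding h_def by (rule infsum_cmult_left')
      finally show "((\<lambda>p. (\<lambda>(x, y). ?F x * ?G y) (snd (\<rho>, p))) has_sum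
          h \<rho> \<tau> * ee (M.phase \<tau> \<rho> + cform M (of_lat \<rho>) \<zeta>)) (fibre \<rho>)"
        by (simp only: snd_conv case_prod_beta)
    qed
  qed
  moreover have "linear_exp_growth_at_cusps (h \<rho>)" for \<rho>
  proof -
    obtain R where R: "R \<subseteq> ?D"
        "\<forall>\<tau>\<in>uhp. \<forall>x\<in>?D. norm (f x \<tau>) \<le> (\<Sum>r\<in>R. norm (f r \<tau>))"
      using B.fourier_coefficient_bound[OF \<Phi> f] by (elim exE conjE)
    obtain R' where R': "R' \<subseteq> ?D'"
        "\<forall>\<tau>\<in>uhp. \<forall>x\<in>?D'. norm (g x \<tau>) \<le> (\<Sum>r\<in>R'. norm (g r \<tau>))"
      using B'.fourier_coefficient_bound[OF \<Psi> g] by (elim exE conjE)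
    obtain W n where W: "W > 0" "\<forall>\<tau>\<in>uhp. \<forall>\<rho> X. finite X \<longrightarrow> X \<subseteq> fibre \<rho> \<longrightarrow>
        (\<Sum>(x, y)\<in>X. norm (ee (excess \<tau> \<rho> x y))) \<le> (15 * (1 + W / Im \<tau>)) ^ n"
      using finite_sum_excess_bound by (elim exE conjE)
    define F where "F \<tau> = (\<Sum>r\<in>R. norm (f r \<tau>))" for \<tau>
    define G where "G \<tau> = (\<Sum>r\<in>R'. norm (g r \<tau>))" for \<tau>
    have nonneg: "F \<tau> \<ge> 0" "G \<tau> \<ge> 0" for \<tau> by (simp_all add: F_def G_def sum_nonneg)
    define b where "b \<tau> = F \<tau> * G \<tau> * (15 * (1 + W / Im \<tau>)) ^ n" for \<tau>
    have bound: "norm (h \<rho> \<tau>) \<le> b \<tau>" if \<tau>: "\<tau> \<in> uhp" for \<tau>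
    proof -
      have fin: "(\<Sum>p\<in>X. norm (t \<tau> \<rho> p)) \<le> b \<tau>" if X: "finite X" "X \<subseteq> fibre \<rho>" for X
      proof -
        have "(\<Sum>p\<in>X. norm (t \<tau> \<rho> p))
            \<le> (\<Sum>p\<in>X. F \<tau> * G \<tau> * norm (ee (excess \<tau> \<rho> (fst p) (snd p))))"
        proof (rule sum_mono)
          fix p assume "p \<in> X"
          then have p: "(fst p, snd p) \<in> fibre \<rho>" using X(2) by auto
          have "norm (f (fst p) \<tau>) * norm (g (snd p) \<tau>) \<le> F \<tau> * G \<tau>"
            unfolding F_def G_def using R(2)[rule_format, OF \<tau> fibreD(1)[OF p]]
              R'(2)[rule_format, OF \<tau> fibreD(2)[OF p]]
            by (intro mult_mono) (simp_all add: sum_nonneg)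
          then show "norm (t \<tau> \<rho> p) \<le> F \<tau> * G \<tau> * norm (ee (excess \<tau> \<rho> (fst p) (snd p)))"
            unfolding t_def norm_mult by (rule mult_right_mono) simp
        qed
        also have "\<dots> = F \<tau> * G \<tau> * (\<Sum>(x, y)\<in>X. norm (ee (excess \<tau> \<rho> x y)))"
          by (simp add: sum_distrib_left case_prod_beta)
        also have "\<dots> \<le> b \<tau>"
          unfolding b_def using nonneg by (intro mult_left_mono W(2)[rule_format] \<tau> X) simp
        finally show ?thesis .
      qed
      \<comment> \<open>Finite partial sums of norms are bounded by \<open>b \<tau>\<close>, which
        gives absolute summability and the same bound for the infinite sum.\<close>
      have abs: "(\<lambda>p. norm (t \<tau> \<rho> p)) summable_on fibre \<rho>"
        by (rule nonneg_bdd_above_summable_on) (use fin in \<open>auto intro!: bdd_aboveI2\<close>)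
      have "norm (h \<rho> \<tau>) \<le> infsum (\<lambda>p. norm (t \<tau> \<rho> p)) (fibre \<rho>)"
        unfolding h_def by (rule norm_infsum_bound[OF abs])
      also have "\<dots> \<le> b \<tau>" by (rule infsum_le_finite_sums[OF abs fin])
      finally show ?thesis .
    qed
    \<comment> \<open>A complex-valued copy of \<open>b\<close>, because the growth condition
      concerns complex-valued functions.\<close>
    let ?b = "\<lambda>\<tau>. (\<Sum>r\<in>R. complex_of_real (norm (f r \<tau>))) * (\<Sum>r\<in>R'. complex_of_real (norm (g r \<tau>)))
        * (15 * (1 + of_real W * of_real (1 / Im \<tau>))) ^ n"
    have "linear_exp_growth_at_cusps ?b"
      by (intro linear_exp_growth_mult linear_exp_growth_add linear_exp_growth_power
          linear_exp_growth_sum linear_exp_growth_norm linear_exp_growth_const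
          linear_exp_growth_inverse_Im) (use fg gg R(1) R'(1) in auto)
    moreover have "norm (h \<rho> \<tau>) \<le> norm (?b \<tau>)" if "\<tau> \<in> uhp" for \<tau>
    proof -
      have "?b \<tau> = of_real (b \<tau>)" by (simp add: b_def F_def G_def)
      then show ?thesis using bound[OF that] by simp
    qed
    ultimately show ?thesis by (rule linear_exp_growth_mono)
  qed
  ultimately show ?thesis by blast
qed

text \<open>Half-integrality makes the floors in the exponents additive. Membership in
  \<open>Mp2R\<close> gives \<open>\<phi> \<tau> \<noteq> 0\<close>, which splitting possibly
  negative powers requires.\<close>

lemma jacobi_form_mult:
  assumes \<Gamma>: "\<Gamma> \<subseteq> carrier Mp2R" and half: "k \<in> half_integers" "l \<in> half_integers"
    "\<kappa> \<in> half_integers" "\<mu> \<in> half_integers"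
    and \<Phi>: "jacobi_form \<Gamma> k l L B v \<Phi>" and \<Psi>: "jacobi_form \<Gamma> \<kappa> \<mu> L B' v \<Psi>"
  shows "jacobi_form \<Gamma> (k + \<kappa>) (l + \<mu>) L M v (\<lambda>\<tau> \<zeta>. \<Phi> \<tau> \<zeta> * \<Psi> \<tau> \<zeta>)"
proof -
  note J = \<Phi>[unfolded jacobi_form_def] and J' = \<Psi>[unfolded jacobi_form_def]
  note D = J[THEN conjunct2, THEN conjunct2, THEN conjunct2, THEN conjunct1]
  note D' = J'[THEN conjunct2, THEN conjunct2, THEN conjunct2, THEN conjunct1]
  have cform_M: "cform M z w = cform B z w + cform B' z w" for z w
    by (simp add: cform_def complex_eq_iff)
  have floor: "\<lfloor>2 * (a + b)\<rfloor> = \<lfloor>2 * a\<rfloor> + \<lfloor>2 * b\<rfloor>" if "a \<in> half_integers" for a b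
  proof -
    obtain n where "2 * a = of_int n" using \<open>a \<in> half_integers\<close> by (auto simp: half_integers_def Ints_def)
    then show ?thesis by (simp add: distrib_left)
  qed
  have "smooth_on (uhp \<times> UNIV) (\<lambda>z. (\<lambda>(\<tau>, \<zeta>). \<Phi> \<tau> \<zeta>) z * (\<lambda>(\<tau>, \<zeta>). \<Psi> \<tau> \<zeta>) z)"
  proof (rule smooth_on_mult)
    show "open (uhp \<times> UNIV :: (complex \<times> 'a cplx) set)"
      unfolding uhp_def by (intro open_Times open_halfspace_Im_gt open_UNIV)
  qed (rule J[THEN conjunct1] J'[THEN conjunct1])+
  then have "smooth_on (uhp \<times> UNIV) (\<lambda>(\<tau>, \<zeta>). \<Phi> \<tau> \<zeta> * \<Psi> \<tau> \<zeta>)"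
    by (simp add: case_prod_beta')
  moreover have "\<forall>\<tau>\<in>uhp. \<forall>\<zeta>. \<forall>\<sigma>\<in>L. \<forall>\<nu>\<in>L.
      \<Phi> \<tau> (\<zeta> + cscale \<tau> (cext M.pos (of_lat \<sigma>)) + cscale (cnj \<tau>) (cext M.neg (of_lat \<sigma>)) + of_lat \<nu>)
      * \<Psi> \<tau> (\<zeta> + cscale \<tau> (cext M.pos (of_lat \<sigma>)) + cscale (cnj \<tau>) (cext M.neg (of_lat \<sigma>)) + of_lat \<nu>)
      = ee (- \<tau> * csq M (cext M.pos (of_lat \<sigma>)) / 2 - cnj \<tau> * csq M (cext M.neg (of_lat \<sigma>)) / 2
        - cform M (of_lat \<sigma>) \<zeta>) * (\<Phi> \<tau> \<zeta> * \<Psi> \<tau> \<zeta>)"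
    unfolding proj_eq cform_M
  proof (intro ballI allI)
    fix \<tau> \<zeta> \<sigma> \<nu> assume hyps: "\<tau> \<in> uhp" "\<sigma> \<in> L" "\<nu> \<in> L"
    let ?p = "cext B.pos (of_lat \<sigma>)" and ?n = "cext B.neg (of_lat \<sigma>)"
    let ?\<zeta> = "\<zeta> + cscale \<tau> ?p + cscale (cnj \<tau>) ?n + of_lat \<nu>"
    have "\<Phi> \<tau> ?\<zeta> = ee (- \<tau> * csq B ?p / 2 - cnj \<tau> * csq B ?n / 2 - cform B (of_lat \<sigma>) \<zeta>) * \<Phi> \<tau> \<zeta>"
      by (rule J[THEN conjunct2, THEN conjunct1, rule_format, OF hyps])
    moreover have "\<Psi> \<tau> ?\<zeta> = ee (- \<tau> * csq B' ?p / 2 - cnj \<tau> * csq B' ?n / 2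
        - cform B' (of_lat \<sigma>) \<zeta>) * \<Psi> \<tau> \<zeta>"
      by (rule J'[THEN conjunct2, THEN conjunct1, rule_format, OF hyps, unfolded proj_eq])
    moreover have "- \<tau> * (csq B ?p + csq B' ?p) / 2 - cnj \<tau> * (csq B ?n + csq B' ?n) / 2
        - (cform B (of_lat \<sigma>) \<zeta> + cform B' (of_lat \<sigma>) \<zeta>)
      = (- \<tau> * csq B ?p / 2 - cnj \<tau> * csq B ?n / 2 - cform B (of_lat \<sigma>) \<zeta>)
        + (- \<tau> * csq B' ?p / 2 - cnj \<tau> * csq B' ?n / 2 - cform B' (of_lat \<sigma>) \<zeta>)"
      by (simp add: ring_distribs add_divide_distrib)
    ultimately show "\<Phi> \<tau> ?\<zeta> * \<Psi> \<tau> ?\<zeta> = ee (- \<tau> * (csq B ?p + csq B' ?p) / 2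
        - cnj \<tau> * (csq B ?n + csq B' ?n) / 2
        - (cform B (of_lat \<sigma>) \<zeta> + cform B' (of_lat \<sigma>) \<zeta>)) * (\<Phi> \<tau> \<zeta> * \<Psi> \<tau> \<zeta>)"
      by (simp only: ee_add mult_ac)
  qed
  moreover have "\<forall>\<tau>\<in>uhp. \<forall>\<zeta>. \<forall>(A, \<phi>)\<in>\<Gamma>.
      \<Phi> (act A \<tau>) (cscale (1 / jfac A \<tau>) (cext M.pos \<zeta>) + cscale (1 / cnj (jfac A \<tau>)) (cext M.neg \<zeta>))
      * \<Psi> (act A \<tau>) (cscale (1 / jfac A \<tau>) (cext M.pos \<zeta>) + cscale (1 / cnj (jfac A \<tau>)) (cext M.neg \<zeta>))
      = \<phi> \<tau> powi \<lfloor>2 * (k + \<kappa>)\<rfloor> * cnj (\<phi> \<tau>) powi \<lfloor>2 * (l + \<mu>)\<rfloor>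
        * ee (of_real (A$2$1) * csq M (cext M.pos \<zeta>) / (2 * jfac A \<tau>)
          + of_real (A$2$1) * csq M (cext M.neg \<zeta>) / (2 * cnj (jfac A \<tau>))) * (\<Phi> \<tau> \<zeta> * \<Psi> \<tau> \<zeta>)"
    unfolding proj_eq cform_M
  proof (intro ballI allI, unfold split_paired_all prod.case)
    fix \<tau> \<zeta> A \<phi> assume \<tau>: "\<tau> \<in> uhp" and A: "(A, \<phi>) \<in> \<Gamma>"
    let ?p = "cext B.pos \<zeta>" and ?n = "cext B.neg \<zeta>"
    let ?\<zeta> = "cscale (1 / jfac A \<tau>) ?p + cscale (1 / cnj (jfac A \<tau>)) ?n"
    let ?c = "complex_of_real (A$2$1)" and ?j = "2 * jfac A \<tau>" and ?j' = "2 * cnj (jfac A \<tau>)"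
    have "\<Phi> (act A \<tau>) ?\<zeta> = \<phi> \<tau> powi \<lfloor>2 * k\<rfloor> * cnj (\<phi> \<tau>) powi \<lfloor>2 * l\<rfloor>
        * ee (?c * csq B ?p / ?j + ?c * csq B ?n / ?j') * \<Phi> \<tau> \<zeta>"
      using J[THEN conjunct2, THEN conjunct2, THEN conjunct1, rule_format, OF \<tau> A, of \<zeta>]
      by (simp only: prod.case)
    moreover have "\<Psi> (act A \<tau>) ?\<zeta> = \<phi> \<tau> powi \<lfloor>2 * \<kappa>\<rfloor> * cnj (\<phi> \<tau>) powi \<lfloor>2 * \<mu>\<rfloor>
        * ee (?c * csq B' ?p / ?j + ?c * csq B' ?n / ?j') * \<Psi> \<tau> \<zeta>"
      using J'[THEN conjunct2, THEN conjunct2, THEN conjunct1, rule_format, OF \<tau> A, of \<zeta>]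
      by (simp only: prod.case proj_eq)
    moreover have "\<phi> \<tau> \<noteq> 0"
    proof -
      have "A \<in> SL2R" "(\<phi> \<tau>)\<^sup>2 = jfac A \<tau>" using A \<Gamma> \<tau> by (auto simp: Mp2R_def)
      with jfac_nonzero[OF _ \<tau>] show ?thesis by force
    qed
    then have "\<phi> \<tau> powi \<lfloor>2 * (k + \<kappa>)\<rfloor> = \<phi> \<tau> powi \<lfloor>2 * k\<rfloor> * \<phi> \<tau> powi \<lfloor>2 * \<kappa>\<rfloor>"
      "cnj (\<phi> \<tau>) powi \<lfloor>2 * (l + \<mu>)\<rfloor> = cnj (\<phi> \<tau>) powi \<lfloor>2 * l\<rfloor> * cnj (\<phi> \<tau>) powi \<lfloor>2 * \<mu>\<rfloor>"
      unfolding floor[OF half(1)] floor[OF half(2)] by (simp_all add: power_int_add)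
    moreover have "?c * (csq B ?p + csq B' ?p) / ?j + ?c * (csq B ?n + csq B' ?n) / ?j'
        = (?c * csq B ?p / ?j + ?c * csq B ?n / ?j') + (?c * csq B' ?p / ?j + ?c * csq B' ?n / ?j')"
      by (simp add: distrib_left add_divide_distrib)
    ultimately show "\<Phi> (act A \<tau>) ?\<zeta> * \<Psi> (act A \<tau>) ?\<zeta>
        = \<phi> \<tau> powi \<lfloor>2 * (k + \<kappa>)\<rfloor> * cnj (\<phi> \<tau>) powi \<lfloor>2 * (l + \<mu>)\<rfloor>
          * ee (?c * (csq B ?p + csq B' ?p) / ?j + ?c * (csq B ?n + csq B' ?n) / ?j')
          * (\<Phi> \<tau> \<zeta> * \<Psi> \<tau> \<zeta>)"
      by (simp only: ee_add mult_ac)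
  qed
  moreover have "\<forall>\<tau>\<in>uhp. cplx_holomorphic (\<lambda>\<zeta>. \<Phi> \<tau> \<zeta> * \<Psi> \<tau> \<zeta>)"
    using D D' cplx_holomorphic_mult by blast
  ultimately show ?thesis
    unfolding jacobi_form_def by (intro conjI fourier_expansion_mult[OF \<Phi> \<Psi>])
qed

end

theorem proposition3p9:
  fixes L :: "'a::real_normed_vector set" and B\<^sub>L :: "'a \<Rightarrow> 'a \<Rightarrow> real"
    and K :: "'b::real_normed_vector set" and B\<^sub>K :: "'b \<Rightarrow> 'b \<Rightarrow> real"
    and v :: "'a set \<times> 'a set" and w :: "'b set \<times> 'b set"
    and \<iota> :: "'a \<Rightarrow> 'b" and b_pos b_neg a_pos a_neg :: nat
  assumes "even_lattice L B\<^sub>L" and "has_signature B\<^sub>L b_pos b_neg"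
    and "even_lattice K B\<^sub>K" and "has_signature B\<^sub>K a_pos a_neg"
    and "v \<in> Gr B\<^sub>L" and "w \<in> Gr B\<^sub>K"
    and "\<iota> \<in> iso (lattice_group L) (lattice_group K)"
    and "real_ext L \<iota> ` fst v = fst w" and "real_ext L \<iota> ` snd v = snd w"
  shows "a_pos = b_pos \<and> a_neg = b_neg \<and>
    even_lattice L (sum_form L B\<^sub>L \<iota> B\<^sub>K) \<and>
    has_signature (sum_form L B\<^sub>L \<iota> B\<^sub>K) b_pos b_neg \<and>
    v \<in> Gr (sum_form L B\<^sub>L \<iota> B\<^sub>K) \<and>
    (\<forall>\<Gamma> k l \<kappa> \<mu> \<Phi> \<Psi>.
       finite_index_subgroup \<Gamma> \<longrightarrow>
       k \<in> half_integers \<longrightarrow> l \<in> half_integers \<longrightarrow>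
       \<kappa> \<in> half_integers \<longrightarrow> \<mu> \<in> half_integers \<longrightarrow>
       jacobi_form \<Gamma> k l L B\<^sub>L v \<Phi> \<longrightarrow>
       jacobi_form \<Gamma> \<kappa> \<mu> K B\<^sub>K w \<Psi> \<longrightarrow>
       jacobi_form \<Gamma> (k + \<kappa>) (l + \<mu>) L (sum_form L B\<^sub>L \<iota> B\<^sub>K) v
         (\<lambda>\<tau> \<zeta>. \<Phi> \<tau> \<zeta> * \<Psi> \<tau> (cext (real_ext L \<iota>) \<zeta>)))"
proof -
  let ?T = "real_ext L \<iota>"
  note free = even_latticeD(1)[OF assms(1)] even_latticeD(1)[OF assms(3)]
  obtain T: "linear ?T" "bij ?T" "?T ` L = K"
    by (rule real_ext_iso[OF free assms(7)])
  obtain S :: "'a set" where S: "finite S" "independent S" "span S = UNIV"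
    by (rule free_latticeE[OF free(1)]) (rule that, assumption, assumption, assumption)
  have bounded: "bounded_linear ?T" by (rule linear_imp_bounded_linear_finite_span[OF T(1) S])
  define B where "B = (\<lambda>x y. B\<^sub>K (?T x) (?T y))"
  have sum_form: "sum_form L B\<^sub>L \<iota> B\<^sub>K = (\<lambda>x y. B\<^sub>L x y + B x y)"
    by (intro ext) (simp add: sum_form_def B_def)
  have w: "definite_decomposition B\<^sub>K w"
    by (rule even_lattice_definite_decomposition[OF assms(3,6)])
  interpret lattice_decomposition_pair L B\<^sub>L B v
  proof (intro lattice_decomposition_pair.intro lattice_decomposition.intro assms(1,5))
    show "even_lattice L B"
      unfolding B_def by (rule even_lattice_pullback[OF _ free(1) T(1,2)]) (simp only: T(3) assms(3))
    show "v \<in> Gr B"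
      unfolding B_def
      by (rule definite_decomposition.Gr[OF definite_decomposition_pullback[OF w T(1,2) assms(8,9)]])
  qed
  \<comment> \<open>The transported form keeps the signature of \<open>B\<^sub>K\<close> but is now
    decomposed by \<open>v\<close>, as is \<open>B\<^sub>L\<close>. Both signatures are therefore
    the dimensions of the two halves of \<open>v\<close>, which identifies them.\<close>
  have "has_signature B a_pos a_neg"
    unfolding B_def by (rule has_signature_pullback[OF assms(4) T(1,2)])
  note sig = B.has_signature_unique[OF assms(2)] B'.has_signature_unique[OF this]
  have "has_signature M b_pos b_neg"
    unfolding sig(1,2) by (rule M.has_signature_dim[OF S(1,3)])
  moreover have "jacobi_form \<Gamma> (k + \<kappa>) (l + \<mu>) L M v (\<lambda>\<tau> \<zeta>. \<Phi> \<tau> \<zeta> * \<Psi> \<tau> (cext ?T \<zeta>))"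
    if \<Gamma>: "finite_index_subgroup \<Gamma>"
      and half: "k \<in> half_integers" "l \<in> half_integers" "\<kappa> \<in> half_integers" "\<mu> \<in> half_integers"
      and \<Phi>: "jacobi_form \<Gamma> k l L B\<^sub>L v \<Phi>" and \<Psi>: "jacobi_form \<Gamma> \<kappa> \<mu> K B\<^sub>K w \<Psi>"
    for \<Gamma> k l \<kappa> \<mu> \<Phi> \<Psi>
  proof (rule jacobi_form_mult[OF _ half \<Phi>])
    have "\<Gamma> \<subseteq> carrier Mp2Z"
      using \<Gamma> unfolding finite_index_subgroup_def by (blast dest: subgroup.subset)
    then show "\<Gamma> \<subseteq> carrier Mp2R" by (auto simp: Mp2Z_def)
    show "jacobi_form \<Gamma> \<kappa> \<mu> L B v (\<lambda>\<tau> \<zeta>. \<Psi> \<tau> (cext ?T \<zeta>))"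
      unfolding B_def
      by (rule jacobi_form_pullback[OF w T(1,2) bounded assms(8,9)]) (simp only: T(3) \<Psi>)
  qed
  ultimately show ?thesis
    unfolding sum_form using sig M.lattice M.v_Gr by (intro conjI allI impI) simp_all
qed

end
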